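(* Let $\mathbb{L}$ be a complete, algebraically closed non-Archimedean field of characteristic $0$ and let $\phi$ be a rational map over $\mathbb{L}$, in normalized form, of degree $d\geq 2$ with potential good reduction. Then the fixed point locus $\{\zeta\in\mathbb{P}^1_{an}:\phi(\zeta)=\zeta\}$ of $\phi$ in the Berkovich projective line has at most $d+2$ connected components.
   Context: $\mathbb{P}^1_{an}$ is the Berkovich projective line over $\mathbb{L}$ with the weak topology, on which $\phi$ acts continuously. Normalized form: $\phi=F/G$ with $F,G$ coprime and coefficients in the valuation ring $\mathcal{O}_{\mathbb{L}}$, not all in its maximal ideal $m_{\mathbb{L}}$. Reduction: reduce coefficients mod $m_{\mathbb{L}}$ (cancelling common factors) to get a rational map over $\tilde{\mathbb{L}}=\mathcal{O}_{\mathbb{L}}/m_{\mathbb{L}}$; good reduction means this reduction has degree $\deg\phi$. Potential good reduction means some Möbius conjugate $\sigma\circ\phi\circ\sigma^{-1}$, $\sigma\in PGL_2(\mathbb{L})$, has good reduction. *)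

theory Defs
  imports "HOL-Analysis.Analysis" "HOL-Computational_Algebra.Polynomial"
          "HOL-Library.Extended_Nonnegative_Real"
begin

definition nonarch_abs :: "('a::field \<Rightarrow> real) \<Rightarrow> bool" where
  "nonarch_abs v \<longleftrightarrow>
     (\<forall>x. v x \<ge> 0) \<and> (\<forall>x. v x = 0 \<longleftrightarrow> x = 0) \<and>
     (\<forall>x y. v (x * y) = v x * v y) \<and> (\<forall>x y. v (x + y) \<le> max (v x) (v y))"

definition nontrivial_abs :: "('a::field \<Rightarrow> real) \<Rightarrow> bool" where
  "nontrivial_abs v \<longleftrightarrow> (\<exists>x. v x \<noteq> 0 \<and> v x \<noteq> 1)"

definition complete_abs :: "('a::field \<Rightarrow> real) \<Rightarrow> bool" where
  "complete_abs v \<longleftrightarrow>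
     (\<forall>X::nat \<Rightarrow> 'a. (\<forall>e>0. \<exists>N. \<forall>m\<ge>N. \<forall>n\<ge>N. v (X m - X n) < e) \<longrightarrow>
        (\<exists>L. \<forall>e>0. \<exists>N. \<forall>n\<ge>N. v (X n - L) < e))"

definition alg_closed :: "'a::field itself \<Rightarrow> bool" where
  "alg_closed _ \<longleftrightarrow> (\<forall>p::'a poly. degree p \<ge> 1 \<longrightarrow> (\<exists>x. poly p x = 0))"

definition rat_map :: "'a::field poly \<Rightarrow> 'a poly \<Rightarrow> bool" where
  "rat_map F G \<longleftrightarrow> G \<noteq> 0 \<and> coprime F G"

definition rdeg :: "'a::field poly \<Rightarrow> 'a poly \<Rightarrow> nat" where
  "rdeg F G = max (degree F) (degree G)"

definition integral_poly :: "('a::field \<Rightarrow> real) \<Rightarrow> 'a poly \<Rightarrow> bool" where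
  "integral_poly v P \<longleftrightarrow> (\<forall>i. v (coeff P i) \<le> 1)"

definition normalized :: "('a::field \<Rightarrow> real) \<Rightarrow> 'a poly \<Rightarrow> 'a poly \<Rightarrow> bool" where
  "normalized v F G \<longleftrightarrow> integral_poly v F \<and> integral_poly v G \<and>
     (\<exists>i. v (coeff F i) = 1 \<or> v (coeff G i) = 1)"

text \<open>Reduction modulo the maximal ideal, expressed on representatives in O[T]:
  the reduction of P is zero iff all coefficients lie in m; its degree is the
  largest index of a coefficient not in m; H~ divides P~ in the residue
  polynomial ring iff P - H Q has all coefficients in m for some Q in O[T].\<close>

definition red_zero :: "('a::field \<Rightarrow> real) \<Rightarrow> 'a poly \<Rightarrow> bool" where
  "red_zero v P \<longleftrightarrow> (\<forall>i. v (coeff P i) < 1)"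

definition red_deg :: "('a::field \<Rightarrow> real) \<Rightarrow> 'a poly \<Rightarrow> nat" where
  "red_deg v P = (if red_zero v P then 0 else (GREATEST i. \<not> v (coeff P i) < 1))"

definition red_dvd :: "('a::field \<Rightarrow> real) \<Rightarrow> 'a poly \<Rightarrow> 'a poly \<Rightarrow> bool" where
  "red_dvd v H P \<longleftrightarrow> (\<exists>Q. integral_poly v Q \<and> red_zero v (P - H * Q))"

text \<open>Degree of the reduced rational map F~/G~ after cancelling common factors:
  max(deg F~, deg G~) minus the degree of gcd(F~, G~).\<close>
definition red_map_degree :: "('a::field \<Rightarrow> real) \<Rightarrow> 'a poly \<Rightarrow> 'a poly \<Rightarrow> nat" where
  "red_map_degree v F G =
     max (red_deg v F) (red_deg v G) -
     (GREATEST k. \<exists>H. integral_poly v H \<and> \<not> red_zero v H \<and> red_deg v H = k \<and>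
                       red_dvd v H F \<and> red_dvd v H G)"

definition good_reduction :: "('a::field \<Rightarrow> real) \<Rightarrow> 'a poly \<Rightarrow> 'a poly \<Rightarrow> bool" where
  "good_reduction v F G \<longleftrightarrow> normalized v F G \<and> red_map_degree v F G = rdeg F G"

definition hsub :: "'a::field poly \<Rightarrow> nat \<Rightarrow> 'a poly \<Rightarrow> 'a poly \<Rightarrow> 'a poly" where
  "hsub P d A B = (\<Sum>i\<le>d. smult (coeff P i) (A ^ i * B ^ (d - i)))"

text \<open>For sigma(z) = (a z + b)/(c z + e), the conjugate sigma o phi o sigma^-1 has
  numerator conj_num and denominator conj_den (sigma^-1(z) = (e z - b)/(-c z + a)).\<close>
definition conj_num :: "'a::field \<Rightarrow> 'a \<Rightarrow> 'a \<Rightarrow> 'a \<Rightarrow> 'a poly \<Rightarrow> 'a poly \<Rightarrow> 'a poly" where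
  "conj_num a b c e F G =
     (let d = rdeg F G; A = [:-b, e:]; B = [:a, -c:]
      in smult a (hsub F d A B) + smult b (hsub G d A B))"

definition conj_den :: "'a::field \<Rightarrow> 'a \<Rightarrow> 'a \<Rightarrow> 'a \<Rightarrow> 'a poly \<Rightarrow> 'a poly \<Rightarrow> 'a poly" where
  "conj_den a b c e F G =
     (let d = rdeg F G; A = [:-b, e:]; B = [:a, -c:]
      in smult c (hsub F d A B) + smult e (hsub G d A B))"

definition potential_good_reduction :: "('a::field \<Rightarrow> real) \<Rightarrow> 'a poly \<Rightarrow> 'a poly \<Rightarrow> bool" where
  "potential_good_reduction v F G \<longleftrightarrow>
     (\<exists>a b c e. a * e - b * c \<noteq> 0 \<and>
        (\<exists>l. l \<noteq> 0 \<and> good_reduction v (smult l (conj_num a b c e F G))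
                                          (smult l (conj_den a b c e F G))))"

text \<open>Points of the Berkovich affine line: multiplicative seminorms on L[T] extending
  the absolute value of L.  The Berkovich projective line adds the point None (= infinity).\<close>

definition mult_seminorm :: "('a::field \<Rightarrow> real) \<Rightarrow> ('a poly \<Rightarrow> real) \<Rightarrow> bool" where
  "mult_seminorm v s \<longleftrightarrow>
     (\<forall>p. s p \<ge> 0) \<and> (\<forall>c. s [:c:] = v c) \<and>
     (\<forall>p q. s (p * q) = s p * s q) \<and> (\<forall>p q. s (p + q) \<le> s p + s q)"

definition berk_P1 :: "('a::field \<Rightarrow> real) \<Rightarrow> ('a poly \<Rightarrow> real) option set" where
  "berk_P1 v = insert None (Some ` {s. mult_seminorm v s})"

definition berk_val :: "('a::field \<Rightarrow> real) \<Rightarrow> ('a poly \<Rightarrow> real) option \<Rightarrow> 'a poly \<Rightarrow> ennreal" where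
  "berk_val v x f = (case x of
       None \<Rightarrow> (if degree f = 0 then ennreal (v (coeff f 0)) else \<infinity>)
     | Some s \<Rightarrow> ennreal (s f))"

text \<open>Weak topology: the coarsest topology making all x \<mapsto> [f]_x continuous.\<close>
definition berk_top :: "('a::field \<Rightarrow> real) \<Rightarrow> ('a poly \<Rightarrow> real) option topology" where
  "berk_top v = pullback_topology (berk_P1 v) (berk_val v) euclidean"

definition type1 :: "('a::field \<Rightarrow> real) \<Rightarrow> 'a \<Rightarrow> ('a poly \<Rightarrow> real) option" where
  "type1 v c = Some (\<lambda>g. v (poly g c))"

text \<open>Action of phi = F/G on the Berkovich line:
  [g]_{phi(x)} = [G^n g(F/G)]_x / [G]_x^n (n = deg g) when [G]_x \<noteq> 0, else phi(x) = infinity;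
  phi(infinity) is the classical value of phi at infinity.\<close>
definition berk_map :: "('a::field \<Rightarrow> real) \<Rightarrow> 'a poly \<Rightarrow> 'a poly \<Rightarrow>
    ('a poly \<Rightarrow> real) option \<Rightarrow> ('a poly \<Rightarrow> real) option" where
  "berk_map v F G x = (case x of
       None \<Rightarrow> (if degree F > degree G then None
               else if degree F = degree G then type1 v (lead_coeff F / lead_coeff G)
               else type1 v 0)
     | Some s \<Rightarrow> (if s G = 0 then None
                 else Some (\<lambda>g. s (hsub g (degree g) F G) / s G ^ degree g)))"

definition fixed_locus :: "('a::field \<Rightarrow> real) \<Rightarrow> 'a poly \<Rightarrow> 'a poly \<Rightarrow> ('a poly \<Rightarrow> real) option set" where
  "fixed_locus v F G = {x \<in> berk_P1 v. berk_map v F G x = x}"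

end

theory Submission
  imports Defs
begin

text \<open>
  Let \<zeta> be the point of the Berkovich line that becomes the Gauss point in the coordinate z where
  the map has good reduction. Every fixed point s which is not of type I is joined to \<zeta> by fixed
  points: after z \<mapsto> 1/z if necessary, s(z) \<le> 1, and the arc consists of the seminorms s_t with
  s_t(z - c) = max (s(z - c)) t for 0 \<le> t \<le> 1. As the map does not increase distances inside
  the unit disc, s_t can only move downwards. It does not: if e is the diameter of s and
  s(z - a) = r is close to e, then F - (F(a)/G(a)) G = (z - a) H where s(H) \<ge> e/r, because
  s(F - b G) = s(z - b) \<ge> e for b = F(a)/G(a). Hence all components of the fixed locus,
  except possibly the one of \<zeta>, contain one of the at most d + 1 classical fixed points.
\<close>

section \<open>Homogeneous substitution\<close>

text \<open>The quotient s_t(F - b G) / s_t(z - a) = s_t(H) can only grow along the arc, since s_t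
  >= s. This is the mechanism of the Schwarz lemma: a map that fixes s does not contract at the
  scale e of s, hence it does not contract at a larger scale t either. The obstacle is that e is an
  infimum which no centre a need attain. So the factor at the lower end is known only to be at least
  e/r, and r must be taken close enough to e for the loss to be harmless; this uses e > 0, which
  comes from completeness. Points of the Berkovich line are never classified by type. Since the
  field is algebraically closed, a seminorm is determined by its values on z - c, and almost every
  claim is checked there. The d + 1 classical fixed points are roots of F - z G, together with
  infinity if deg F > deg G.\<close>

lemma smult_sum_right: "smult c (\<Sum>i\<in>I. f i) = (\<Sum>i\<in>I. smult c (f i))"
  by (induction I rule: infinite_finite_induct) (auto simp: smult_add_right)

lemma hsub_add: "hsub (p + q) n A B = hsub p n A B + hsub q n A B"
  by (simp add: hsub_def smult_add_left sum.distrib)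

lemma hsub_smult: "hsub (smult c p) n A B = smult c (hsub p n A B)"
  by (simp add: hsub_def smult_sum_right)

lemma hsub_0 [simp]: "hsub 0 n A B = 0"
  by (simp add: hsub_def)

lemma hsub_sum: "hsub (\<Sum>i\<in>I. f i) n A B = (\<Sum>i\<in>I. hsub (f i) n A B)"
  by (induction I rule: infinite_finite_induct) (auto simp: hsub_add)

text \<open>Horner's rule for B^n p(A/B). The inductions below rest on it and so avoid index shifts
  in the defining sum.\<close>

lemma hsub_pCons: "hsub (pCons a p) (Suc n) A B = smult a (B ^ Suc n) + A * hsub p n A B"
  unfolding hsub_def sum.atMost_Suc_shift
  by (simp add: sum_distrib_left mult.assoc)

lemma hsub_const: "hsub [:c:] n A B = smult c (B ^ n)"
  by (cases n) (simp_all add: hsub_pCons, simp add: hsub_def)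

lemma hsub_linear: "hsub [:q, p:] (Suc 0) A B = smult p A + smult q B"
  by (simp add: hsub_pCons hsub_const)

text \<open>The degree bound matters: \<open>hsub p n\<close> ignores the coefficients of p above
  n.\<close>

lemma hsub_raise:
  assumes "degree p \<le> n"
  shows "hsub p (n + m) A B = hsub p n A B * B ^ m"
  using assms
proof (induction p arbitrary: n)
  case (pCons a p)
  show ?case
  proof (cases n)
    case 0
    then have "p = 0" using pCons by (auto split: if_splits)
    then show ?thesis by (simp add: hsub_const power_add)
  next
    case (Suc k)
    then have "degree p \<le> k" using pCons by (cases "p = 0") auto
    then show ?thesis using Suc pCons.IH[of k]
      by (simp add: hsub_pCons algebra_simps power_add)
  qed
qed simp

lemma hsub_mult:
  assumes "degree p \<le> n" "degree q \<le> m"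
  shows "hsub (p * q) (n + m) A B = hsub p n A B * hsub q m A B"
  using assms(1)
proof (induction p arbitrary: n)
  case (pCons a p)
  show ?case
  proof (cases n)
    case 0
    then have "p = 0" using pCons by (auto split: if_splits)
    with 0 show ?thesis by (simp add: hsub_const hsub_smult)
  next
    case (Suc k)
    then have "degree p \<le> k" using pCons by (cases "p = 0") auto
    then have "hsub (p * q) (k + m) A B = hsub p k A B * hsub q m A B"
      by (rule pCons.IH)
    moreover have "hsub q (m + Suc k) A B = hsub q m A B * B ^ Suc k"
      by (rule hsub_raise[OF assms(2)])
    ultimately show ?thesis using Suc hsub_pCons[of 0 "p * q" "k + m" A B]
      by (simp add: hsub_add hsub_smult hsub_pCons algebra_simps)
  qed
qed simp

lemma degree_linear_power: "degree (p ^ k) \<le> k" if "degree (p :: 'a::field poly) \<le> Suc 0"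
  using degree_power_le[of p k] mult_le_mono1[OF that, of k] by linarith

lemma hsub_power:
  assumes "degree p \<le> Suc 0"
  shows "hsub (p ^ k) k A B = hsub p (Suc 0) A B ^ k"
proof (induction k)
  case 0
  then show ?case by (simp add: hsub_const flip: pCons_one)
next
  case (Suc k)
  have "degree (p ^ k) \<le> k"
    using assms by (rule degree_linear_power)
  then show ?case using hsub_mult[OF assms, of "p ^ k" k A B] Suc by simp
qed

lemma degree_linear_power_mult:
  assumes "degree (A :: 'a::field poly) \<le> Suc 0" "degree B \<le> Suc 0" "i \<le> d"
  shows "degree (A ^ i) \<le> i" "degree (B ^ (d - i)) \<le> d - i" "degree (A ^ i * B ^ (d - i)) \<le> d"
proof -
  show "degree (A ^ i) \<le> i" "degree (B ^ (d - i)) \<le> d - i" by (rule degree_linear_power, fact)+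
  then show "degree (A ^ i * B ^ (d - i)) \<le> d"
    using degree_mult_le[of "A ^ i" "B ^ (d - i)"] assms(3) by linarith
qed

lemma degree_hsub_le:
  assumes "degree A \<le> Suc 0" "degree B \<le> Suc 0"
  shows "degree (hsub P d A B) \<le> d"
  unfolding hsub_def
  by (intro degree_sum_le)
    (auto intro: degree_linear_power_mult(3)[OF assms] order.trans[OF degree_smult_le])

text \<open>Each term A^i B^(d-i) is a form of degree d, split as i + (d - i), so substitution acts
  on its factors separately. Hence changes of coordinate compose like matrices.\<close>

lemma hsub_hsub:
  assumes "degree A \<le> Suc 0" "degree B \<le> Suc 0"
  shows "hsub (hsub P d A B) d C D = hsub P d (hsub A (Suc 0) C D) (hsub B (Suc 0) C D)"
proof -
  have "hsub (A ^ i * B ^ (d - i)) d C D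
      = hsub A (Suc 0) C D ^ i * hsub B (Suc 0) C D ^ (d - i)" if "i \<le> d" for i
    using hsub_mult[OF degree_linear_power_mult(1,2)[OF assms that], of C D] that
    by (simp add: hsub_power assms)
  then show ?thesis
    unfolding hsub_def[of P] by (simp add: hsub_sum hsub_smult)
qed

text \<open>A 2x2 matrix times its adjugate is the determinant k times the identity; on forms of
  degree d this scalar matrix acts as k^d.\<close>

lemma hsub_scaled_id:
  assumes "degree P \<le> d"
  shows "hsub P d [:0, k:] [:k:] = smult (k ^ d) P"
  using assms
proof (induction P arbitrary: d)
  case (pCons a p)
  show ?case
  proof (cases d)
    case 0
    then have "p = 0" using pCons by (auto split: if_splits)
    with 0 show ?thesis by (simp add: hsub_const)
  next
    case (Suc k)
    then have "degree p \<le> k" using pCons by (cases "p = 0") auto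
    then show ?thesis using pCons.IH[of k] Suc
      by (simp add: hsub_pCons smult_pCons flip: power_Suc)
        (simp add: poly_const_pow ac_simps)
  qed
qed simp

section \<open>Multiplicative seminorms\<close>

locale nonarch_field =
  fixes v :: "'a::field \<Rightarrow> real"
  assumes nonarch: "nonarch_abs v" and closed: "alg_closed TYPE('a)"
begin

lemma v_nonneg [simp]: "v x \<ge> 0"
  and v_eq_0_iff [simp]: "v x = 0 \<longleftrightarrow> x = 0"
  and v_mult: "v (x * y) = v x * v y"
  and v_add_le: "v (x + y) \<le> max (v x) (v y)"
  using nonarch by (auto simp: nonarch_abs_def)

lemma v_0 [simp]: "v 0 = 0" by simp

lemma v_1 [simp]: "v 1 = 1"
  using v_mult[of 1 1] v_eq_0_iff[of 1] by (metis mult_cancel_right1 mult_1 zero_neq_one)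

lemma v_power: "v (x ^ n) = v x ^ n"
  by (induction n) (auto simp: v_mult)

lemma v_uminus [simp]: "v (- x) = v x"
proof -
  have "v (- 1) ^ 2 = 1" using v_power[of "- 1" 2] by simp
  then have "v (- 1) = 1" by (metis power2_eq_1_iff v_nonneg neg_0_le_iff_le not_one_le_zero)
  then show ?thesis using v_mult[of "- 1" x] by simp
qed

lemma v_divide: "v (x / y) = v x / v y"
proof (cases "y = 0")
  case False
  then show ?thesis using v_mult[of "x / y" y] by (simp add: field_simps)
qed simp

text \<open>Serves to bound the binomial coefficients in the proof of the ultrametric inequality for
  seminorms.\<close>

lemma v_of_nat_le_1: "v (of_nat n) \<le> 1"
proof (induction n)
  case (Suc n)
  then show ?case using v_add_le[of 1 "of_nat n"] by auto
qed simp

lemma v_sum_le: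
  assumes "\<And>i. i \<in> I \<Longrightarrow> v (f i) \<le> M" "0 \<le> M"
  shows "v (sum f I) \<le> M"
  using assms
proof (induction I rule: infinite_finite_induct)
  case (insert i I)
  then show ?case using v_add_le[of "f i" "sum f I"] by fastforce
qed auto

lemma v_sum_less:
  assumes "finite I" "\<And>i. i \<in> I \<Longrightarrow> v (f i) < M" "0 < M"
  shows "v (sum f I) < M"
  using assms
proof (induction I rule: finite_induct)
  case (insert i I)
  then show ?case using v_add_le[of "f i" "sum f I"] by fastforce
qed auto

lemma v_add_eq:
  assumes "v y < v x"
  shows "v (x + y) = v x"
proof (rule antisym)
  show "v (x + y) \<le> v x" using v_add_le[of x y] assms by simp
  show "v x \<le> v (x + y)" using v_add_le[of "x + y" "- y"] assms by simp
qed

text \<open>Over an algebraically closed field every polynomial is a product of constants and monic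
  linear factors. Multiplicative functions can therefore be studied on z - c alone.\<close>

lemma split_induct [case_names const linear mult]:
  fixes f :: "'a poly"
  assumes "\<And>c. P [:c:]" "\<And>c. P [:- c, 1:]" "\<And>f g. P f \<Longrightarrow> P g \<Longrightarrow> P (f * g)"
  shows "P f"
proof (induction "degree f" arbitrary: f rule: less_induct)
  case less
  show ?case
  proof (cases "degree f = 0")
    case True
    then show ?thesis using assms(1) by (metis degree_eq_zeroE)
  next
    case False
    then have "degree f \<ge> 1" by simp
    then obtain x where "poly f x = 0"
      using closed by (auto simp: alg_closed_def)
    then obtain g where g: "f = [:- x, 1:] * g" by (auto simp: poly_eq_0_iff_dvd)
    then have "g \<noteq> 0" using False by auto
    then have "degree f = Suc (degree g)" unfolding g by (subst degree_mult_eq) auto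
    then have "P g" using less by simp
    with assms(2) show ?thesis unfolding g by (rule assms(3))
  qed
qed

abbreviation seminorm :: "('a poly \<Rightarrow> real) \<Rightarrow> bool" where
  "seminorm s \<equiv> mult_seminorm v s"

context
  fixes s assumes s: "seminorm s"
begin

lemma sn_nonneg [simp]: "s p \<ge> 0"
  and sn_const [simp]: "s [:c:] = v c"
  and sn_mult: "s (p * q) = s p * s q"
  and sn_triangle: "s (p + q) \<le> s p + s q"
  using s by (auto simp: mult_seminorm_def)

lemma sn_0 [simp]: "s 0 = 0" using sn_const[of 0] by (simp del: sn_const)

lemma sn_1 [simp]: "s 1 = 1" using sn_const[of 1] by (simp del: sn_const add: one_pCons)

lemma sn_smult: "s (smult c p) = v c * s p"
  using sn_mult[of "[:c:]" p] by simp

lemma sn_power: "s (p ^ n) = s p ^ n"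
  by (induction n) (auto simp: sn_mult)

lemma sn_uminus [simp]: "s (- p) = s p"
  using sn_smult[of "- 1" p] by simp

lemma sn_sum_le: "s (sum f I) \<le> (\<Sum>i\<in>I. s (f i))"
proof (induction I rule: infinite_finite_induct)
  case (insert i I)
  then show ?case using sn_triangle[of "f i" "sum f I"] by simp
qed auto

text \<open>Only the archimedean triangle inequality is assumed of a seminorm; the ultrametric one
  follows by comparing the growth of both sides of the binomial expansion of the n-th power.\<close>

lemma sn_add_le: "s (p + q) \<le> max (s p) (s q)"
proof (rule ccontr)
  define M where "M = max (s p) (s q)"
  define x where "x = s (p + q)"
  assume "\<not> ?thesis"
  then have x: "M < x" by (simp add: M_def x_def not_le)
  have M: "0 \<le> M" by (simp add: M_def le_max_iff_disj)
  have bound: "x ^ n \<le> real (Suc n) * M ^ n" for n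
  proof -
    have "x ^ n = s (\<Sum>k\<le>n. of_nat (n choose k) * p ^ k * q ^ (n - k))"
      by (simp add: x_def sn_power flip: binomial_ring)
    also have "\<dots> \<le> (\<Sum>k\<le>n. s (of_nat (n choose k) * p ^ k * q ^ (n - k)))"
      by (rule sn_sum_le)
    also have "\<dots> \<le> (\<Sum>k\<le>n. M ^ n)"
    proof (rule sum_mono)
      fix k assume "k \<in> {..n}"
      then have k: "k \<le> n" by simp
      have "s (of_nat (n choose k) * p ^ k * q ^ (n - k)) = v (of_nat (n choose k)) * (s p ^ k * s q ^ (n - k))"
        by (simp add: sn_mult sn_power of_nat_poly sn_smult)
      also have "\<dots> \<le> 1 * (M ^ k * M ^ (n - k))"
        by (intro mult_mono power_mono v_of_nat_le_1) (auto simp: M_def le_max_iff_disj)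
      also have "\<dots> = M ^ n" using k by (simp flip: power_add)
      finally show "s (of_nat (n choose k) * p ^ k * q ^ (n - k)) \<le> M ^ n" .
    qed
    finally show ?thesis by simp
  qed
  \<comment> \<open>If M were 0, the bound for n = 1 would already give x <= 0.\<close>
  have "M \<noteq> 0" using bound[of 1] x M by auto
  then have M0: "M > 0" using M by simp
  define y where "y = x / M"
  have y: "y > 1" using x M0 by (simp add: y_def)
  have "y ^ n \<le> real (Suc n)" for n
    using bound[of n] M0 by (simp add: y_def power_divide field_simps)
  then have le: "1 \<le> real n / y ^ n + 1 / y ^ n" for n
    using y by (simp add: field_simps)
  have "(\<lambda>n. 1 / y ^ n) \<longlonglongrightarrow> 0"
    using y LIMSEQ_power_zero[of "1 / y"] by (simp add: power_divide)
  moreover have "(\<lambda>n. real n / y ^ n) \<longlonglongrightarrow> 0"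
    using lim_n_over_pown[of y] y by simp
  ultimately have "(\<lambda>n. real n / y ^ n + 1 / y ^ n) \<longlonglongrightarrow> 0 + 0"
    by (intro tendsto_add)
  then have "(1::real) \<le> 0 + 0" using le by (intro LIMSEQ_le_const) auto
  then show False by simp
qed

lemma sn_diff_le: "s (p - q) \<le> max (s p) (s q)"
  using sn_add_le[of p "- q"] by simp

lemma sn_add_eq:
  assumes "s q < s p"
  shows "s (p + q) = s p"
proof (rule antisym)
  show "s (p + q) \<le> s p" using sn_add_le[of p q] assms by simp
  show "s p \<le> s (p + q)" using sn_diff_le[of "p + q" q] assms by simp
qed

lemma sn_linear: "p \<noteq> 0 \<Longrightarrow> s [:q, p:] = v p * s [:- (- q / p), 1:]"
  using sn_smult[of p "[:- (- q / p), 1:]"] by simp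

lemma v_diff_le_sn: "v (a - b) \<le> max (s [:- a, 1:]) (s [:- b, 1:])"
  using sn_diff_le[of "[:- a, 1:]" "[:- b, 1:]"] v_uminus[of "a - b"] by simp

lemma sn_linear_le: "s [:- a, 1:] \<le> max (s [:- b, 1:]) (v (a - b))"
  using sn_diff_le[of "[:- b, 1:]" "[:a - b:]"] by simp

end

text \<open>Nonnegativity allows the inequalities for the linear factors to be multiplied. This is
  the source of the monotonicity of the arc.\<close>

lemma sn_mono:
  assumes "seminorm s" "seminorm s'" "\<And>c. s [:- c, 1:] \<le> s' [:- c, 1:]"
  shows "s f \<le> s' f"
proof (induction f rule: split_induct)
  case (mult f g)
  then show ?case by (simp add: sn_mult assms mult_mono sn_nonneg)
qed (auto simp: assms sn_const)

lemma sn_eqI: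
  assumes "seminorm s" "seminorm s'" "\<And>c. s [:- c, 1:] = s' [:- c, 1:]"
  shows "s = s'"
  using sn_mono[of s s'] sn_mono[of s' s] assms by (intro ext antisym) auto

text \<open>Excludes the points of type I: by \<open>sn_eq_type1\<close>, a seminorm that vanishes
  at some z - c is evaluation at c.\<close>

definition no_zero :: "('a poly \<Rightarrow> real) \<Rightarrow> bool" where
  "no_zero s \<longleftrightarrow> (\<forall>c. s [:- c, 1:] \<noteq> 0)"

lemma no_zeroD:
  assumes "seminorm s" "no_zero s" "f \<noteq> 0"
  shows "s f \<noteq> 0"
  using assms(3)
proof (induction f rule: split_induct)
  case (const c)
  then show ?case using assms by (simp add: sn_const)
next
  case (linear c)
  then show ?case using assms by (simp add: no_zero_def)
next
  case (mult f g)
  then show ?case using assms by (auto simp: sn_mult)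
qed

text \<open>If s(z - c) = 0, then z may be replaced by c in z - a, and the ultrametric inequality in
  both directions gives s(z - a) = |c - a|.\<close>

lemma sn_eq_type1:
  assumes "seminorm s" "s [:- c, 1:] = 0"
  shows "Some s = type1 v c"
proof -
  have "s f = v (poly f c)" for f
  proof (induction f rule: split_induct)
    case (linear a)
    have "s [:- a, 1:] \<le> v (c - a)"
      using sn_linear_le[OF assms(1), of a c] assms(2) v_uminus[of "a - c"] by simp
    moreover have "v (c - a) \<le> s [:- a, 1:]"
      using v_diff_le_sn[OF assms(1), of c a] assms sn_nonneg[OF assms(1)] by simp
    ultimately show ?case by simp
  qed (auto simp: assms sn_const sn_mult v_mult)
  then show ?thesis by (auto simp: type1_def)
qed

section \<open>Disc seminorms\<close>

text \<open>The core of Gauss's lemma. With m and n the last indices of maximal weight, every other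
  pair with sum m + n has its first index beyond m or its second beyond n, so its product is
  strictly smaller and cannot cancel the main term. At radius 1 it also serves for reduction modulo
  the maximal ideal.\<close>

lemma coeff_mult_dominant:
  assumes "t > 0" "M > 0" "N > 0"
    and p: "\<And>i. v (coeff p i) * t ^ i \<le> M" "v (coeff p m) * t ^ m = M"
      "\<And>i. i > m \<Longrightarrow> v (coeff p i) * t ^ i < M"
    and q: "\<And>i. v (coeff q i) * t ^ i \<le> N" "v (coeff q n) * t ^ n = N"
      "\<And>i. i > n \<Longrightarrow> v (coeff q i) * t ^ i < N"
  shows "v (coeff (p * q) (m + n)) * t ^ (m + n) = M * N"
proof -
  define g where "g i = coeff p i * coeff q (m + n - i)" for i
  have g: "v (g i) * t ^ (m + n) = (v (coeff p i) * t ^ i) * (v (coeff q (m + n - i)) * t ^ (m + n - i))"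
    if "i \<le> m + n" for i
  proof -
    have "t ^ (m + n) = t ^ i * t ^ (m + n - i)" using that by (simp flip: power_add)
    then show ?thesis by (simp add: g_def v_mult)
  qed
  have gm: "v (g m) * t ^ (m + n) = M * N" using g[of m] p(2) q(2) by simp
  have strict: "x * y < X * Y" if "x \<le> X" "y < Y" "0 \<le> y" "0 < X" for x y X Y :: real
    using mult_right_mono[of x X y] mult_strict_left_mono[of y Y X] that by linarith
  have less: "v (g i) < v (g m)" if i: "i \<in> {..m + n} - {m}" for i
  proof -
    have "(v (coeff p i) * t ^ i) * (v (coeff q (m + n - i)) * t ^ (m + n - i)) < M * N"
    proof (cases "i < m")
      case True
      then have "v (coeff q (m + n - i)) * t ^ (m + n - i) < N" by (intro q(3)) simp
      then show ?thesis
        using p(1)[of i] assms(1-3) by (intro strict) auto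
    next
      case False
      then have "v (coeff p i) * t ^ i < M" using i by (intro p(3)) auto
      then show ?thesis
        unfolding mult.commute[of M N] mult.commute[of "v (coeff p i) * t ^ i"]
        using q(1)[of "m + n - i"] assms(1-3) by (intro strict) auto
    qed
    then have "v (g i) * t ^ (m + n) < v (g m) * t ^ (m + n)" using g[of i] gm i by simp
    then show ?thesis using assms(1) by simp
  qed
  have "coeff (p * q) (m + n) = g m + sum g ({..m + n} - {m})"
    by (simp add: coeff_mult g_def sum.remove[of "{..m + n}" m])
  moreover have "v (sum g ({..m + n} - {m})) < v (g m)"
  proof (rule v_sum_less)
    have "0 < v (g m) * t ^ (m + n)" using gm assms by simp
    then show "0 < v (g m)" using assms(1) by (simp add: zero_less_mult_iff)
  qed (use less in auto)
  ultimately show ?thesis using gm by (simp add: v_add_eq)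
qed

definition gauss :: "real \<Rightarrow> 'a poly \<Rightarrow> real" where
  "gauss t p = Max ((\<lambda>i. v (coeff p i) * t ^ i) ` {..degree p})"

text \<open>The point attached to the disc of radius r about a: the Gauss norm of the expansion in
  powers of z - a.\<close>

definition disc :: "'a \<Rightarrow> real \<Rightarrow> 'a poly \<Rightarrow> real" where
  "disc a r f = gauss r (pcompose f [:a, 1:])"

context
  fixes t :: real assumes t: "t > 0"
begin

lemma gauss_attained: "\<exists>i. gauss t p = v (coeff p i) * t ^ i"
proof -
  have "gauss t p \<in> (\<lambda>i. v (coeff p i) * t ^ i) ` {..degree p}"
    unfolding gauss_def by (rule Max_in) auto
  then show ?thesis by auto
qed

lemma gauss_nonneg: "gauss t p \<ge> 0"
  using gauss_attained[of p] t by auto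

lemma gauss_ge: "v (coeff p i) * t ^ i \<le> gauss t p"
proof (cases "i \<le> degree p")
  case True
  then show ?thesis unfolding gauss_def by (intro Max_ge) auto
next
  case False
  then show ?thesis using gauss_nonneg by (simp add: coeff_eq_0)
qed

lemma gauss_le: "(\<And>i. v (coeff p i) * t ^ i \<le> M) \<Longrightarrow> gauss t p \<le> M"
  using gauss_attained[of p] by auto

lemma gauss_pos: "p \<noteq> 0 \<Longrightarrow> gauss t p > 0"
proof -
  assume "p \<noteq> 0"
  then have "0 < v (lead_coeff p)" by (simp add: less_le)
  then have "0 < v (lead_coeff p) * t ^ degree p" using t by simp
  also have "\<dots> \<le> gauss t p" by (rule gauss_ge)
  finally show ?thesis .
qed

lemma gauss_dominant:
  assumes "p \<noteq> 0"
  obtains m where "v (coeff p m) * t ^ m = gauss t p"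
    "\<And>i. i > m \<Longrightarrow> v (coeff p i) * t ^ i < gauss t p"
proof -
  define S where "S = {i. v (coeff p i) * t ^ i = gauss t p}"
  have "S \<subseteq> {..degree p}"
    using gauss_pos[OF assms] by (auto simp: S_def intro!: le_degree)
  then have fin: "finite S" by (rule finite_subset) simp
  have "S \<noteq> {}" using gauss_attained[of p] by (auto simp: S_def)
  then have "Max S \<in> S" using fin by (rule Max_in[rotated])
  then have "v (coeff p (Max S)) * t ^ Max S = gauss t p" by (simp add: S_def)
  moreover have "v (coeff p i) * t ^ i < gauss t p" if "i > Max S" for i
  proof -
    have "i \<notin> S" using that fin Max_ge leD by blast
    then show ?thesis using gauss_ge[of p i] by (simp add: S_def)
  qed
  ultimately show ?thesis by (rule that)
qed

lemma gauss_mult: "gauss t (p * q) = gauss t p * gauss t q"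
proof (cases "p = 0 \<or> q = 0")
  case True
  then show ?thesis by (auto simp: gauss_def)
next
  case False
  show ?thesis
  proof (rule antisym)
    have "v (coeff (p * q) k) * t ^ k \<le> gauss t p * gauss t q" for k
    proof -
      have "v (coeff p i * coeff q (k - i)) \<le> gauss t p * gauss t q / t ^ k" if "i \<le> k" for i
      proof -
        have "t ^ k = t ^ i * t ^ (k - i)" using that by (simp flip: power_add)
        then have "v (coeff p i * coeff q (k - i)) * t ^ k
            = (v (coeff p i) * t ^ i) * (v (coeff q (k - i)) * t ^ (k - i))"
          by (simp add: v_mult)
        also have "\<dots> \<le> gauss t p * gauss t q"
          using t by (intro mult_mono gauss_ge gauss_nonneg) auto
        finally show ?thesis using t by (simp add: field_simps)
      qed
      then have "v (coeff (p * q) k) \<le> gauss t p * gauss t q / t ^ k"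
        unfolding coeff_mult using t gauss_nonneg by (intro v_sum_le) auto
      then show ?thesis using t by (simp add: field_simps)
    qed
    then show "gauss t (p * q) \<le> gauss t p * gauss t q" by (rule gauss_le)
  next
    obtain m where m: "v (coeff p m) * t ^ m = gauss t p"
      "\<And>i. i > m \<Longrightarrow> v (coeff p i) * t ^ i < gauss t p"
      using gauss_dominant False by blast
    obtain n where n: "v (coeff q n) * t ^ n = gauss t q"
      "\<And>i. i > n \<Longrightarrow> v (coeff q i) * t ^ i < gauss t q"
      using gauss_dominant False by blast
    have "v (coeff (p * q) (m + n)) * t ^ (m + n) = gauss t p * gauss t q"
      by (intro coeff_mult_dominant t gauss_pos gauss_ge m n) (use False in auto)
    then show "gauss t p * gauss t q \<le> gauss t (p * q)" by (metis gauss_ge)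
  qed
qed

lemma gauss_seminorm: "seminorm (gauss t)"
  unfolding mult_seminorm_def
proof (intro conjI allI)
  fix p q
  have "v (coeff (p + q) i) * t ^ i \<le> gauss t p + gauss t q" for i
  proof -
    have "v (coeff (p + q) i) \<le> v (coeff p i) + v (coeff q i)"
      using v_add_le[of "coeff p i" "coeff q i"] v_nonneg[of "coeff p i"] v_nonneg[of "coeff q i"]
      by (simp del: v_nonneg)
    then have "v (coeff (p + q) i) * t ^ i \<le> (v (coeff p i) + v (coeff q i)) * t ^ i"
      using t by (intro mult_right_mono) auto
    also have "\<dots> \<le> gauss t p + gauss t q"
      using gauss_ge[of p i] gauss_ge[of q i] by (simp add: algebra_simps)
    finally show ?thesis .
  qed
  then show "gauss t (p + q) \<le> gauss t p + gauss t q" by (rule gauss_le)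
qed (auto simp: gauss_nonneg gauss_mult, simp add: gauss_def)

lemma gauss_linear: "gauss t [:a, 1:] = max (v a) t"
proof -
  have "{..Suc 0} = {0, Suc 0}" by auto
  then show ?thesis by (simp add: gauss_def)
qed

lemma disc_seminorm: "seminorm (disc a t)"
proof -
  note g = gauss_seminorm
  show ?thesis
    unfolding mult_seminorm_def disc_def pcompose_mult pcompose_add pcompose_const
    by (intro conjI allI sn_nonneg[OF g] sn_const[OF g] sn_mult[OF g] sn_triangle[OF g])
qed

lemma disc_linear: "disc a t [:- c, 1:] = max (v (a - c)) t"
  using gauss_linear[of "a - c"] by (simp add: disc_def pcompose_pCons)

end

section \<open>Integral polynomials\<close>

lemma integral_poly_pCons: "integral_poly v (pCons a p) \<longleftrightarrow> v a \<le> 1 \<and> integral_poly v p"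
  by (auto simp: integral_poly_def coeff_pCons split: nat.splits)

lemma integral_poly_eval_le:
  assumes "seminorm s" "s [:0, 1:] \<le> 1" "integral_poly v f"
  shows "s f \<le> 1"
  using assms(3)
proof (induction f)
  case (pCons a f)
  have "s (pCons a f) = s ([:a:] + [:0, 1:] * f)" by simp
  also have "\<dots> \<le> max (v a) (s [:0, 1:] * s f)"
    using sn_add_le[OF assms(1)] by (metis sn_const sn_mult assms(1))
  also have "\<dots> \<le> 1"
    using pCons assms mult_le_one[of "s [:0, 1:]" "s f"]
    by (auto simp: integral_poly_pCons sn_nonneg)
  finally show ?case .
qed (simp add: assms sn_0)

lemma integral_poly_at_le:
  assumes "v a \<le> 1" "integral_poly v f"
  shows "v (poly f a) \<le> 1"
  using assms(2)
proof (induction f)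
  case (pCons c f)
  have "v (poly (pCons c f) a) \<le> max (v c) (v a * v (poly f a))"
    using v_add_le[of c "a * poly f a"] by (simp add: v_mult)
  also have "\<dots> \<le> 1"
    using pCons assms mult_le_one[of "v a" "v (poly f a)"] by (auto simp: integral_poly_pCons)
  finally show ?case .
qed simp

text \<open>As in Horner's scheme, the coefficients of the quotient by z - a are the values at a of
  the tails of f.\<close>

lemma integral_synthetic_div:
  assumes "v a \<le> 1" "integral_poly v f"
  shows "integral_poly v (synthetic_div f a)"
  using assms(2)
proof (induction f)
  case (pCons c f)
  then show ?case using assms(1)
    by (auto simp: integral_poly_pCons intro: integral_poly_at_le)
qed simp

lemma integral_poly_diff_smult:
  assumes "v c \<le> 1" "integral_poly v f" "integral_poly v g"
  shows "integral_poly v (f - smult c g)"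
  unfolding integral_poly_def
proof
  fix i
  have "v (c * coeff g i) \<le> 1"
    using assms by (simp add: v_mult mult_le_one integral_poly_def)
  moreover have "v (coeff f i) \<le> 1" using assms by (simp add: integral_poly_def)
  ultimately show "v (coeff (f - smult c g) i) \<le> 1"
    using v_add_le[of "coeff f i" "- (c * coeff g i)"] by simp
qed

text \<open>f - f(a) = (z - a) K with K integral, so passing between s and the point a costs at most
  s(z - a): integral polynomials are 1-Lipschitz on the unit disc.\<close>

lemma sn_near_value:
  assumes "seminorm s" "s [:0, 1:] \<le> 1" "integral_poly v f" "v a \<le> 1"
  shows "s f \<le> max (v (poly f a)) (s [:- a, 1:])" "v (poly f a) \<le> max (s f) (s [:- a, 1:])"
proof -
  define K where "K = synthetic_div f a"
  have f: "f = [:- a, 1:] * K + [:poly f a:]"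
    using synthetic_div_correct'[of a f] by (simp add: K_def)
  have "s K \<le> 1"
    unfolding K_def
    by (rule integral_poly_eval_le[OF assms(1,2) integral_synthetic_div[OF assms(4,3)]])
  then have le: "s ([:- a, 1:] * K) \<le> s [:- a, 1:]"
    by (subst sn_mult[OF assms(1)]) (intro mult_left_le sn_nonneg[OF assms(1)])
  have "s f = s ([:- a, 1:] * K + [:poly f a:])" by (rule arg_cong[OF f])
  also have "\<dots> \<le> max (s ([:- a, 1:] * K)) (v (poly f a))"
    using sn_add_le[OF assms(1), of "[:- a, 1:] * K" "[:poly f a:]"]
    by (simp only: sn_const[OF assms(1)])
  finally show "s f \<le> max (v (poly f a)) (s [:- a, 1:])" using le by linarith
  have "f - [:- a, 1:] * K = [:poly f a:]" using f by (metis add_diff_cancel_left')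
  then have "v (poly f a) \<le> max (s f) (s ([:- a, 1:] * K))"
    using sn_diff_le[OF assms(1), of f "[:- a, 1:] * K"] by (simp only: sn_const[OF assms(1)])
  then show "v (poly f a) \<le> max (s f) (s [:- a, 1:])" using le by linarith
qed

section \<open>Push-forward of seminorms\<close>

text \<open>The image of s under A/B. It is used both for the map itself and for Moebius changes of
  coordinate.\<close>

definition push :: "'a poly \<Rightarrow> 'a poly \<Rightarrow> ('a poly \<Rightarrow> real) \<Rightarrow> 'a poly \<Rightarrow> real" where
  "push A B s g = s (hsub g (degree g) A B) / s B ^ degree g"

text \<open>A larger exponent multiplies numerator and denominator by the same power of s(B).
  Polynomials of different degrees thus get a common denominator.\<close>

lemma push_eq:
  assumes "seminorm s" "s B \<noteq> 0" "degree g \<le> n"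
  shows "push A B s g = s (hsub g n A B) / s B ^ n"
proof -
  obtain k where n: "n = degree g + k" using assms(3) le_Suc_ex by blast
  show ?thesis
    using assms(2) by (simp add: push_def n hsub_raise sn_mult[OF assms(1)] sn_power[OF assms(1)] power_add)
qed

lemma push_linear:
  assumes "seminorm s" "s B \<noteq> 0"
  shows "push A B s [:q, p:] = s (smult p A + smult q B) / s B"
  using push_eq[OF assms, of "[:q, p:]" "Suc 0" A] by (simp add: hsub_linear)

lemma push_seminorm:
  assumes s: "seminorm s" and B: "s B \<noteq> 0"
  shows "seminorm (push A B s)"
  unfolding mult_seminorm_def
proof (intro conjI allI)
  fix p q c
  show "0 \<le> push A B s p" by (simp add: push_def sn_nonneg[OF s])
  show "push A B s [:c:] = v c" by (simp add: push_def hsub_const sn_const[OF s])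
  show "push A B s (p * q) = push A B s p * push A B s q"
    using push_eq[OF s B degree_mult_le[of p q], of A] hsub_mult[of p _ q, OF order_refl order_refl, of A B]
    by (simp add: push_def sn_mult[OF s] power_add)
  define n where "n = max (degree p) (degree q)"
  have n: "degree p \<le> n" "degree q \<le> n" "degree (p + q) \<le> n"
    by (auto simp: n_def degree_add_le_max)
  have "s (hsub (p + q) n A B) \<le> s (hsub p n A B) + s (hsub q n A B)"
    unfolding hsub_add by (rule sn_triangle[OF s])
  then show "push A B s (p + q) \<le> push A B s p + push A B s q"
    using sn_nonneg[OF s, of B]
    by (simp add: push_eq[OF s B n(1)] push_eq[OF s B n(2)] push_eq[OF s B n(3)] divide_right_mono
        flip: add_divide_distrib)
qed

lemma berk_map_Some:
  "s G \<noteq> 0 \<Longrightarrow> berk_map v F G (Some s) = Some (push F G s)"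
  by (simp add: berk_map_def push_def fun_eq_iff)

text \<open>A seminorm is determined by its values on linear polynomials, so fixedness can be
  expressed there; the following form is symmetric in the homogeneous coordinates.\<close>

definition lin_fixed :: "('a poly \<Rightarrow> real) \<Rightarrow> 'a poly \<Rightarrow> 'a poly \<Rightarrow> bool" where
  "lin_fixed s F G \<longleftrightarrow> s G \<noteq> 0 \<and> (\<forall>p q. s (smult p F + smult q G) = s G * s [:q, p:])"

lemma lin_fixedI:
  assumes "seminorm s" "k \<noteq> 0" "\<And>p q. s (smult p F + smult q G) = k * s [:q, p:]"
  shows "lin_fixed s F G"
proof -
  have "s G = k" using assms(3)[of 0 1] by (simp add: sn_const[OF assms(1)])
  then show ?thesis using assms by (simp add: lin_fixed_def)
qed

lemma berk_map_fixed_iff: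
  assumes "seminorm s"
  shows "berk_map v F G (Some s) = Some s \<longleftrightarrow> lin_fixed s F G"
proof (cases "s G = 0")
  case True
  then show ?thesis by (simp add: berk_map_def lin_fixed_def)
next
  case False
  show ?thesis
  proof
    assume "berk_map v F G (Some s) = Some s"
    then have "push F G s = s" using False by (simp add: berk_map_Some)
    then have "s [:q, p:] = s (smult p F + smult q G) / s G" for p q
      using push_linear[OF assms False] by metis
    then show "lin_fixed s F G" using False by (simp add: lin_fixed_def)
  next
    assume fixd: "lin_fixed s F G"
    have "push F G s = s"
    proof (rule sn_eqI[OF push_seminorm[OF assms False] assms])
      fix c
      have "s (smult 1 F + smult (- c) G) = s G * s [:- c, 1:]"
        using fixd unfolding lin_fixed_def by blast
      then show "push F G s [:- c, 1:] = s [:- c, 1:]"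
        using False by (simp add: push_linear[OF assms False])
    qed
    then show "berk_map v F G (Some s) = Some s" using False by (simp add: berk_map_Some)
  qed
qed

text \<open>The hypotheses on hsub say that F/G composed with A/B equals A/B composed with F'/G'.\<close>

lemma lin_fixed_push:
  assumes s: "seminorm s" and fixd: "lin_fixed s F' G'" and B: "s [:b0, b1:] \<noteq> 0"
    and deg: "degree F \<le> d" "degree G \<le> d" and k: "k \<noteq> 0"
    and F: "smult k (hsub F d [:a0, a1:] [:b0, b1:]) = smult a1 F' + smult a0 G'"
    and G: "smult k (hsub G d [:a0, a1:] [:b0, b1:]) = smult b1 F' + smult b0 G'"
  shows "lin_fixed (push [:a0, a1:] [:b0, b1:] s) F G"
proof -
  let ?A = "[:a0, a1:]" and ?B = "[:b0, b1:]"
  note sB = push_seminorm[OF s B]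
  \<comment> \<open>The shape of the factor is irrelevant as long as it is not 0:
    \<open>lin_fixedI\<close> identifies it as the value at G.\<close>
  have "push ?A ?B s (smult p F + smult q G)
      = s G' * s ?B / (v k * s ?B ^ d) * push ?A ?B s [:q, p:]" for p q
  proof -
    have "degree (smult p F + smult q G) \<le> d"
      using deg by (intro degree_add_le order.trans[OF degree_smult_le])
    then have 1: "push ?A ?B s (smult p F + smult q G)
        = s (smult p (hsub F d ?A ?B) + smult q (hsub G d ?A ?B)) / s ?B ^ d"
      by (subst push_eq[OF s B]) (simp_all add: hsub_add hsub_smult)
    have "v k * s (smult p (hsub F d ?A ?B) + smult q (hsub G d ?A ?B))
      = s (smult p (smult k (hsub F d ?A ?B)) + smult q (smult k (hsub G d ?A ?B)))"
      by (subst sn_smult[OF s, symmetric]) (simp only: smult_add_right smult_smult mult.commute)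
    also have "\<dots> = s (smult (p * a1 + q * b1) F' + smult (p * a0 + q * b0) G')"
      unfolding F G by (rule arg_cong[where f = s]) (simp add: smult_add_right smult_add_left algebra_simps)
    also have "\<dots> = s G' * s [:p * a0 + q * b0, p * a1 + q * b1:]"
      using fixd by (simp add: lin_fixed_def)
    also have "[:p * a0 + q * b0, p * a1 + q * b1:] = smult p ?A + smult q ?B" by simp
    also have "s (smult p ?A + smult q ?B) = s ?B * push ?A ?B s [:q, p:]"
      using B by (simp only: push_linear[OF s B]) simp
    finally show ?thesis using B k unfolding 1 by (simp add: field_simps)
  qed
  then show ?thesis
    by (rule lin_fixedI[OF sB, rotated]) (use B k fixd in \<open>auto simp: lin_fixed_def\<close>)
qed

lemma push_no_zero:
  assumes s: "seminorm s" "no_zero s" and "a1 * b0 \<noteq> a0 * b1"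
  shows "no_zero (push [:a0, a1:] [:b0, b1:] s)"
  unfolding no_zero_def
proof
  fix c
  have B: "s [:b0, b1:] \<noteq> 0" using assms by (intro no_zeroD) auto
  have "smult 1 [:a0, a1:] + smult (- c) [:b0, b1:] \<noteq> 0"
    using assms(3) by auto
  then have "s (smult 1 [:a0, a1:] + smult (- c) [:b0, b1:]) \<noteq> 0" using s no_zeroD by blast
  then show "push [:a0, a1:] [:b0, b1:] s [:- c, 1:] \<noteq> 0"
    using B by (simp only: push_linear[OF s(1) B]) simp
qed

section \<open>Arcs of fixed points\<close>

text \<open>Continuity for each f separately is what the weak topology asks for. Requiring
  \<open>no_zero\<close> along the whole arc ensures that no Moebius change of coordinate sends one
  of its points to infinity.\<close>

definition fixed_arc :: "'a poly \<Rightarrow> 'a poly \<Rightarrow> ('a poly \<Rightarrow> real) \<Rightarrow> ('a poly \<Rightarrow> real) \<Rightarrow> bool" where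
  "fixed_arc F G s s' \<longleftrightarrow> (\<exists>\<gamma>. \<gamma> 0 = s \<and> \<gamma> 1 = s' \<and>
     (\<forall>t\<in>{0..1::real}. seminorm (\<gamma> t) \<and> no_zero (\<gamma> t) \<and> lin_fixed (\<gamma> t) F G) \<and>
     (\<forall>f. continuous_on {0..1} (\<lambda>t. \<gamma> t f)))"

lemma fixed_arc_push:
  assumes arc: "fixed_arc F' G' s s'" and det: "a1 * b0 \<noteq> a0 * b1"
    and deg: "degree F \<le> d" "degree G \<le> d" and k: "k \<noteq> 0"
    and F: "smult k (hsub F d [:a0, a1:] [:b0, b1:]) = smult a1 F' + smult a0 G'"
    and G: "smult k (hsub G d [:a0, a1:] [:b0, b1:]) = smult b1 F' + smult b0 G'"
  shows "fixed_arc F G (push [:a0, a1:] [:b0, b1:] s) (push [:a0, a1:] [:b0, b1:] s')"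
proof -
  obtain \<gamma> where g: "\<gamma> 0 = s" "\<gamma> 1 = s'"
    "\<And>t. t \<in> {0..1} \<Longrightarrow> seminorm (\<gamma> t) \<and> no_zero (\<gamma> t) \<and> lin_fixed (\<gamma> t) F' G'"
    "\<And>f. continuous_on {0..1::real} (\<lambda>t. \<gamma> t f)"
    using arc unfolding fixed_arc_def by blast
  have B: "\<gamma> t [:b0, b1:] \<noteq> 0" if "t \<in> {0..1}" for t
    using g(3)[OF that] det by (intro no_zeroD) auto
  show ?thesis
    unfolding fixed_arc_def
  proof (intro exI[of _ "\<lambda>t. push [:a0, a1:] [:b0, b1:] (\<gamma> t)"] conjI ballI allI)
    fix f show "continuous_on {0..1} (\<lambda>t. push [:a0, a1:] [:b0, b1:] (\<gamma> t) f)"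
      unfolding push_def using B by (intro continuous_intros g) auto
  next
    fix t :: real assume t: "t \<in> {0..1}"
    then have *: "seminorm (\<gamma> t)" "no_zero (\<gamma> t)" "lin_fixed (\<gamma> t) F' G'" using g(3) by auto
    show "seminorm (push [:a0, a1:] [:b0, b1:] (\<gamma> t))"
      by (rule push_seminorm[OF *(1) B[OF t]])
    show "no_zero (push [:a0, a1:] [:b0, b1:] (\<gamma> t))"
      by (rule push_no_zero[OF *(1,2) det])
    show "lin_fixed (push [:a0, a1:] [:b0, b1:] (\<gamma> t)) F G"
      by (rule lin_fixed_push[OF *(1,3) B[OF t] deg k F G])
  qed (simp_all add: g)
qed

text \<open>The arc from s up to the Gauss point: enlarging s to radius t is a disc seminorm as soon as
  t exceeds the diameter of s, whatever the type of s.\<close>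

definition enlarge :: "('a poly \<Rightarrow> real) \<Rightarrow> real \<Rightarrow> 'a poly \<Rightarrow> real" where
  "enlarge s t = (if \<exists>a. s [:- a, 1:] < t then disc (SOME a. s [:- a, 1:] < t) t else s)"

context
  fixes s assumes s: "seminorm s"
begin

lemma enlarge_cases:
  obtains "enlarge s t = s" "\<And>a. t \<le> s [:- a, 1:]"
  | a where "enlarge s t = disc a t" "s [:- a, 1:] < t" "t > 0"
proof (cases "\<exists>a. s [:- a, 1:] < t")
  case True
  then have *: "s [:- (SOME a. s [:- a, 1:] < t), 1:] < t" by (rule someI_ex)
  show ?thesis
  proof (rule that(2)[OF _ *])
    show "t > 0" using * sn_nonneg[OF s] by (rule le_less_trans[rotated])
  qed (use True in \<open>simp add: enlarge_def\<close>)
next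
  case False
  then have "enlarge s t = s" by (simp only: enlarge_def if_False)
  moreover have "t \<le> s [:- a, 1:]" for a using False by (meson not_less)
  ultimately show ?thesis by (rule that(1))
qed

lemma enlarge_seminorm: "seminorm (enlarge s t)"
  by (cases rule: enlarge_cases[of t]) (auto simp: s disc_seminorm)

text \<open>The arbitrary centre a drops out: as s(z - a) < t, the numbers |a - c| and s(z - c)
  agree once both are cut off below at t.\<close>

lemma enlarge_linear: "enlarge s t [:- c, 1:] = max (s [:- c, 1:]) t"
proof (cases rule: enlarge_cases[of t])
  case 1
  then show ?thesis using 1(2)[of c] by (simp only: max.absorb1)
next
  case (2 a)
  have "enlarge s t [:- c, 1:] = max (v (a - c)) t" using 2 by (simp add: disc_linear)
  moreover have "v (c - a) = v (a - c)" using v_uminus[of "a - c"] by simp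
  ultimately show ?thesis
    using v_diff_le_sn[OF s, of a c] sn_linear_le[OF s, of c a] 2(2) by linarith
qed

lemma enlarge_ge: "s f \<le> enlarge s t f"
  by (rule sn_mono[OF s enlarge_seminorm]) (simp add: enlarge_linear)

lemma enlarge_0: "enlarge s 0 = s"
  by (rule sn_eqI[OF enlarge_seminorm s]) (simp add: enlarge_linear sn_nonneg[OF s])

lemma enlarge_1:
  assumes "s [:0, 1:] \<le> 1"
  shows "enlarge s 1 = disc 0 1"
proof (rule sn_eqI[OF enlarge_seminorm disc_seminorm])
  fix c
  show "enlarge s 1 [:- c, 1:] = disc 0 1 [:- c, 1:]"
    using sn_linear_le[OF s, of c 0] v_diff_le_sn[OF s, of c 0] assms
    by (simp add: enlarge_linear disc_linear)
qed simp

lemma enlarge_continuous: "continuous_on T (\<lambda>t. enlarge s t f)"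
proof (induction f rule: split_induct)
  case (mult f g)
  then show ?case by (simp add: sn_mult[OF enlarge_seminorm] continuous_on_mult)
next
  case (linear c)
  then show ?case by (simp add: enlarge_linear continuous_on_max)
qed (simp add: sn_const[OF enlarge_seminorm])

end

text \<open>Completeness rules out points of diameter zero other than those of type I.\<close>

lemma diameter_pos:
  assumes s: "seminorm s" "no_zero s" and comp: "complete_abs v"
  obtains e where "e > 0" "\<And>c. e \<le> s [:- c, 1:]" "\<And>x. e < x \<Longrightarrow> \<exists>c. s [:- c, 1:] < x"
proof -
  define e where "e = (INF c. s [:- c, 1:])"
  have bdd: "bdd_below (range (\<lambda>c. s [:- c, 1:]))"
    by (rule bdd_belowI[of _ 0]) (auto simp: sn_nonneg[OF s(1)])
  have 1: "e \<le> s [:- c, 1:]" for c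
    unfolding e_def by (rule cINF_lower[OF bdd]) simp
  have 2: "\<exists>c. s [:- c, 1:] < x" if "e < x" for x
    using that unfolding e_def by (subst (asm) cINF_less_iff[OF _ bdd]) auto
  have "e > 0"
  proof (rule ccontr)
    assume "\<not> e > 0"
    then have "\<exists>c. s [:- c, 1:] < 1 / real (Suc n)" for n
      by (intro 2) (simp add: not_less order.strict_trans1)
    \<comment> \<open>The centres X n form a Cauchy sequence, and its limit L would satisfy s(z - L)
      = 0, making s a point of type I.\<close>
    then obtain X where X: "\<And>n. s [:- X n, 1:] < 1 / real (Suc n)" by metis
    have small: "\<exists>N. \<forall>n\<ge>N. s [:- X n, 1:] < x" if "x > 0" for x
    proof -
      obtain N where N: "1 / real (Suc N) < x" using \<open>x > 0\<close> nat_approx_posE by blast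
      have "s [:- X n, 1:] < x" if "n \<ge> N" for n
      proof -
        have "1 / real (Suc n) \<le> 1 / real (Suc N)" using that by (simp add: frac_le)
        then show ?thesis using X[of n] N by linarith
      qed
      then show ?thesis by blast
    qed
    have "\<exists>N. \<forall>m\<ge>N. \<forall>n\<ge>N. v (X m - X n) < x" if "x > 0" for x
    proof -
      obtain N where N: "\<forall>n\<ge>N. s [:- X n, 1:] < x" using small[OF \<open>x > 0\<close>] by blast
      have "v (X m - X n) < x" if "m \<ge> N" "n \<ge> N" for m n
        using v_diff_le_sn[OF s(1), of "X m" "X n"] N[rule_format, OF that(1)] N[rule_format, OF that(2)]
        by linarith
      then show ?thesis by blast
    qed
    then obtain L where L: "\<And>x. x > 0 \<Longrightarrow> \<exists>N. \<forall>n\<ge>N. v (X n - L) < x"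
      using comp unfolding complete_abs_def by metis
    have "s [:- L, 1:] < x" if "x > 0" for x
    proof -
      obtain N N' where N: "\<forall>n\<ge>N. s [:- X n, 1:] < x" "\<forall>n\<ge>N'. v (X n - L) < x"
        using small[OF \<open>x > 0\<close>] L[OF \<open>x > 0\<close>] by blast
      then have "s [:- X (max N N'), 1:] < x" "v (X (max N N') - L) < x" by auto
      then show ?thesis
        using sn_linear_le[OF s(1), of L "X (max N N')"] v_uminus[of "X (max N N') - L"] by simp
    qed
    then have "s [:- L, 1:] \<le> 0" by (meson dense_ge less_imp_le)
    then have "s [:- L, 1:] = 0" using sn_nonneg[OF s(1)] by (intro antisym)
    then show False using s(2) by (simp add: no_zero_def)
  qed
  then show ?thesis using 1 2 that by blast
qed

text \<open>If |c| > 1, the term c G dominates. Otherwise the upper bound is the Lipschitz estimate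
  applied twice at the centre \<open>a0\<close>, from \<open>enlarge s t\<close> to
  \<open>a0\<close> and from there to s; the lower bound is the non-contraction argument, by
  contradiction.\<close>

lemma enlarge_fixed_linear:
  assumes s: "seminorm s" "no_zero s" and comp: "complete_abs v"
    and z: "s [:0, 1:] \<le> 1" and int: "integral_poly v F" "integral_poly v G"
    and fixd: "\<And>c. s (F - smult c G) = s [:- c, 1:]" and sG: "s G = 1"
    and t: "t \<le> 1"
  shows "enlarge s t (F - smult c G) = max (s [:- c, 1:]) t"
proof (cases rule: enlarge_cases[OF s(1), of t])
  case 1
  then show ?thesis using fixd 1(2)[of c] by (simp only: max.absorb1)
next
  case (2 a0)
  let ?E = "enlarge s t"
  note E = enlarge_seminorm[OF s(1), of t]
  have Elin: "?E [:- x, 1:] = max (s [:- x, 1:]) t" for x by (rule enlarge_linear[OF s(1)])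
  have Ez: "?E [:0, 1:] \<le> 1" using Elin[of 0] z t by simp
  \<comment> \<open>s(G) = 1 bounds the value below, since \<open>enlarge s t\<close> lies above s;
    integrality of G bounds it above.\<close>
  have EG: "?E G = 1"
    using enlarge_ge[OF s(1), of G t] sG integral_poly_eval_le[OF E Ez int(2)] by linarith
  have near: "v a \<le> 1" if "s [:- a, 1:] \<le> 1" for a
    using v_diff_le_sn[OF s(1), of a 0] that z by simp
  show ?thesis
  proof (cases "v c \<le> 1")
    case False
    have "s [:- c, 1:] = v c"
      using v_diff_le_sn[OF s(1), of c 0] sn_linear_le[OF s(1), of c 0] False z by simp
    moreover have "?E (- smult c G) = v c" using EG by (simp add: sn_smult[OF E] sn_uminus[OF E])
    moreover have "?E F \<le> 1" by (rule integral_poly_eval_le[OF E Ez int(1)])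
    ultimately show ?thesis
      using False t sn_add_eq[OF E, of F "- smult c G"] by simp
  next
    case True
    define f where "f = F - smult c G"
    have intf: "integral_poly v f"
      unfolding f_def by (rule integral_poly_diff_smult[OF True int])
    have a0: "v a0 \<le> 1" using 2 t by (intro near) linarith
    have "?E f \<le> max (v (poly f a0)) (?E [:- a0, 1:])"
      by (rule sn_near_value(1)[OF E Ez intf a0])
    moreover have "v (poly f a0) \<le> max (s f) (s [:- a0, 1:])"
      by (rule sn_near_value(2)[OF s(1) z intf a0])
    moreover have "s f = s [:- c, 1:]" unfolding f_def by (rule fixd)
    ultimately have upper: "?E f \<le> max (s [:- c, 1:]) t"
      using Elin[of a0] 2(2) by linarith
    have "s [:- c, 1:] \<le> ?E f" using enlarge_ge[OF s(1), of f t] fixd f_def by simp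
    moreover have "t \<le> ?E f"
    proof (rule ccontr)
      assume "\<not> t \<le> ?E f"
      then have x: "?E f < t" by simp
      then have c: "s [:- c, 1:] < t" using \<open>s [:- c, 1:] \<le> ?E f\<close> by linarith
      obtain e where e: "e > 0" "\<And>c. e \<le> s [:- c, 1:]" "\<And>x. e < x \<Longrightarrow> \<exists>c. s [:- c, 1:] < x"
        by (rule diameter_pos[OF s comp]) blast
      have et: "e < t" using e(2)[of c] c by linarith
      \<comment> \<open>M is chosen so that every a with r < min M (e t / M) violates the bound: the value
        of s_t at F - b G is at least t e / r > M, but also at most M as b is close to c.\<close>
      define M where "M = max (max (?E f) (s [:- c, 1:])) ((e + t) / 2)"
      have M: "M < t" "M > 0" "e < M" using x c et e(1) by (auto simp: M_def less_max_iff_disj)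
      have "e < min M (e * t / M)" using M e(1) by (simp add: field_simps)
      then obtain a where a: "s [:- a, 1:] < min M (e * t / M)" using e(3) by blast
      define r where "r = s [:- a, 1:]"
      have r: "r < M" "r < e * t / M" "r \<ge> e" using a e(2) by (auto simp: r_def)
      have va: "v a \<le> 1" using r M t by (intro near) (simp add: r_def)
      \<comment> \<open>s(G) = 1 is at most max |G(a)| r, and r < M < t <= 1, so |G(a)| cannot be
        small.\<close>
      have Ga: "poly G a \<noteq> 0"
        using sn_near_value(1)[OF s(1) z int(2) va] sG r M t by (auto simp: r_def)
      have vGa: "v (poly G a) = 1"
        using sn_near_value(1)[OF s(1) z int(2) va] sG r M t integral_poly_at_le[OF va int(2)]
        by (auto simp: r_def max_def split: if_splits)
      \<comment> \<open>The value of the map at a, so that z - a divides F - b G. It is integral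
        because |G(a)| = 1.\<close>
      define b where "b = poly F a / poly G a"
      have vb: "v b \<le> 1"
        using integral_poly_at_le[OF va int(1)] vGa by (simp add: b_def v_divide)
      define H where "H = synthetic_div (F - smult b G) a"
      have intH: "integral_poly v H"
        unfolding H_def by (intro integral_synthetic_div va integral_poly_diff_smult vb int)
      have "poly (F - smult b G) a = 0" using Ga by (simp add: b_def)
      then have H: "F - smult b G = [:- a, 1:] * H"
        using synthetic_div_correct'[of a "F - smult b G"] by (simp add: H_def)
      have sb: "s [:- b, 1:] = r * s H"
        using fixd[of b] H sn_mult[OF s(1)] r_def by metis
      have "s H \<le> 1" by (rule integral_poly_eval_le[OF s(1) z intH])
      then have sb_le: "s [:- b, 1:] \<le> r"
        unfolding sb using r e(1) by (intro mult_left_le) auto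
      have "e \<le> r * s H" using e(2)[of b] sb by simp
      then have "e / r \<le> s H" using r e(1) by (simp add: field_simps)
      also have "s H \<le> ?E H" by (rule enlarge_ge[OF s(1)])
      finally have "t * (e / r) \<le> t * ?E H" using 2(3) by (intro mult_left_mono) auto
      also have "t * ?E H = ?E (F - smult b G)"
        using Elin[of a] r M by (simp only: H sn_mult[OF E]) (simp add: r_def)
      also have "F - smult b G = f + smult (c - b) G"
        by (simp add: f_def smult_diff_left)
      also have "?E (f + smult (c - b) G) \<le> max (?E f) (v (c - b))"
        using sn_add_le[OF E, of f "smult (c - b) G"] EG by (simp add: sn_smult[OF E])
      also have "\<dots> \<le> M"
        using v_diff_le_sn[OF s(1), of c b] sb_le r by (auto simp: M_def)
      finally have "t * (e / r) \<le> M" .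
      moreover have "M < t * (e / r)" using r e(1) M by (simp add: field_simps)
      ultimately show False by simp
    qed
    ultimately show ?thesis using upper f_def by simp
  qed
qed

section \<open>Arcs ending at the Gauss point\<close>

definition gauss_pt :: "'a poly \<Rightarrow> real" where
  "gauss_pt = disc 0 1"

lemma gauss_pt_seminorm: "seminorm gauss_pt"
  by (simp add: gauss_pt_def disc_seminorm)

lemma gauss_pt_linear: "gauss_pt [:q, p:] = max (v q) (v p)"
proof (cases "p = 0")
  case True
  then show ?thesis by (simp add: sn_const[OF gauss_pt_seminorm] max.absorb1)
next
  case False
  have "gauss_pt [:- (- q / p), 1:] = max (v q / v p) 1"
    unfolding gauss_pt_def by (subst disc_linear) (simp_all add: v_divide)
  then show ?thesis
    using False v_nonneg[of p] sn_linear[OF gauss_pt_seminorm False, of q]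
    by (simp add: max_mult_distrib_left del: v_nonneg)
qed

lemma fixed_arc_gauss_unit_disc:
  assumes s: "seminorm s" "no_zero s" and comp: "complete_abs v"
    and z: "s [:0, 1:] \<le> 1" and int: "integral_poly v F" "integral_poly v G"
    and fixd: "lin_fixed s F G" and norm: "1 \<le> max (s F) (s G)"
  shows "fixed_arc F G s gauss_pt"
proof -
  have lin: "s (smult p F + smult q G) = s G * s [:q, p:]" for p q
    using fixd by (simp add: lin_fixed_def)
  \<comment> \<open>Fixedness at (p, q) = (1, 0) reads s(F) = s(G) s(z). The maximum in
    \<open>norm\<close> is therefore s(G), and integrality gives s(G) = 1.\<close>
  have "s F \<le> s G"
    using lin[of 1 0] z mult_left_le[OF z sn_nonneg[OF s(1), of G]] by simp
  then have sG: "s G = 1" using norm integral_poly_eval_le[OF s(1) z int(2)] by linarith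
  have fix1: "s (F - smult c G) = s [:- c, 1:]" for c
    using lin[of 1 "- c"] sG by simp
  have fixt: "lin_fixed (enlarge s t) F G" if t: "t \<le> 1" for t
  proof (rule lin_fixedI[where k = 1])
    let ?E = "enlarge s t"
    note E = enlarge_seminorm[OF s(1), of t]
    show "seminorm ?E" by (rule E)
    fix p q
    have *: "?E (F - smult c G) = ?E [:- c, 1:]" for c
      using enlarge_fixed_linear[OF s comp z int fix1 sG t] enlarge_linear[OF s(1)] by simp
    show "?E (smult p F + smult q G) = 1 * ?E [:q, p:]"
    proof (cases "p = 0")
      case True
      have "?E [:0, 1:] \<le> 1" using enlarge_linear[OF s(1), of t 0] z t by simp
      then have "?E G = 1"
        using enlarge_ge[OF s(1), of G t] sG integral_poly_eval_le[OF E _ int(2)] by fastforce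
      then show ?thesis using True by (simp add: sn_smult[OF E] sn_const[OF E])
    next
      case False
      then have "smult p F + smult q G = smult p (F - smult (- q / p) G)"
        by (simp add: smult_add_right smult_diff_right)
      then show ?thesis
        using sn_linear[OF E False, of q] *[of "- q / p"] by (simp only: sn_smult[OF E] mult_1)
    qed
  qed simp
  show ?thesis
    unfolding fixed_arc_def gauss_pt_def
  proof (intro exI[of _ "enlarge s"] conjI ballI allI enlarge_0 enlarge_1 enlarge_seminorm
      enlarge_continuous s z fixt)
    fix t :: real
    show "no_zero (enlarge s t)"
      unfolding no_zero_def
      using s(2) sn_nonneg[OF s(1)] by (auto simp: enlarge_linear[OF s(1)] no_zero_def max_def)
        (metis less_eq_real_def not_less order.antisym)
  qed auto
qed

text \<open>The hypothesis \<open>norm\<close> is homogeneous of degree d, so it survives z -> 1/z: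
  dividing by s(z)^d gives the inequality for the reversed polynomials. This reduces s(z) > 1 to the
  unit disc.\<close>

lemma fixed_arc_gauss:
  assumes s: "seminorm s" "no_zero s" and comp: "complete_abs v"
    and int: "integral_poly v F" "integral_poly v G" and deg: "degree F \<le> d" "degree G \<le> d"
    and fixd: "lin_fixed s F G" and norm: "max 1 (s [:0, 1:]) ^ d \<le> max (s F) (s G)"
  shows "fixed_arc F G s gauss_pt"
proof (cases "s [:0, 1:] \<le> 1")
  case True
  then show ?thesis
    using norm by (intro fixed_arc_gauss_unit_disc[OF s comp _ int fixd]) (auto simp: max_absorb1)
next
  case False
  let ?X = "[:0, 1:]" and ?O = "[:1, 0:]"
  \<comment> \<open>R P = z^d P(1/z) reverses the coefficients. In the coordinate 1/z the map F/G
    becomes R G / R F, with numerator and denominator exchanged.\<close>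
  define R where "R P = hsub P d ?O ?X" for P :: "'a poly"
  have RR: "hsub (R P) d ?O ?X = P" if "degree P \<le> d" for P
  proof -
    have "hsub (R P) d ?O ?X = hsub P d [:0, 1:] [:1:]"
      unfolding R_def by (subst hsub_hsub) (simp_all add: hsub_linear hsub_const)
    then show ?thesis using hsub_scaled_id[OF that, of 1] by simp
  qed
  have degR: "degree (R P) \<le> d" for P unfolding R_def by (rule degree_hsub_le) auto
  have intR: "integral_poly v (R P)" if "integral_poly v P" for P
    unfolding integral_poly_def
  proof
    fix i
    have mon: "?O ^ j * ?X ^ (d - j) = monom 1 (d - j)" for j
      by (simp add: monom_altdef flip: one_pCons)
    have "v (coeff (smult (coeff P j) (?O ^ j * ?X ^ (d - j))) i) \<le> 1" for j
      using that unfolding mon by (simp add: integral_poly_def v_mult)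
    then show "v (coeff (R P) i) \<le> 1"
      unfolding R_def hsub_def coeff_sum by (intro v_sum_le) auto
  qed
  have X: "s ?X \<noteq> 0" using False by auto
  define s' where "s' = push ?O ?X s"
  have s': "seminorm s'" "no_zero s'"
    unfolding s'_def using push_seminorm[OF s(1) X] push_no_zero[OF s, of 0 0 1 1]
    by auto
  have swap_lin: "push ?O ?X y [:- c, 1:] = y [:1, - c:] / y ?X" if "seminorm y" "y ?X \<noteq> 0" for y c
    using push_linear[OF that, of ?O "- c" 1] by simp
  have z': "s' [:0, 1:] \<le> 1"
    using swap_lin[OF s(1) X, of 0] False sn_1[OF s(1)] by (simp add: s'_def one_pCons)
  have fix': "lin_fixed s' (R G) (R F)"
    unfolding s'_def
    by (rule lin_fixed_push[OF s(1) fixd X degR degR, where k = 1]) (use RR[OF deg(1)] RR[OF deg(2)] in simp_all)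
  have val: "s' (R P) = s P / s ?X ^ d" if "degree P \<le> d" for P
    unfolding s'_def by (subst push_eq[OF s(1) X degR]) (simp only: RR[OF that])
  have "1 \<le> max (s' (R G)) (s' (R F))"
    using norm False unfolding val[OF deg(1)] val[OF deg(2)]
    by (simp add: max_def field_simps split: if_splits)
  then have "fixed_arc (R G) (R F) s' gauss_pt"
    by (intro fixed_arc_gauss_unit_disc[OF s' comp z' intR intR fix'] int)
  then have "fixed_arc F G (push ?O ?X s') (push ?O ?X gauss_pt)"
    by (rule fixed_arc_push[OF _ _ deg, where k = 1]) (simp_all add: R_def)
  moreover have "push ?O ?X s' = s"
  proof (rule sn_eqI[OF push_seminorm[OF s'(1)] s(1)])
    show X': "s' ?X \<noteq> 0" using s' by (intro no_zeroD) auto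
    fix c
    have "s' [:1, - c:] = s [:- c, 1:] / s ?X"
      unfolding s'_def by (subst push_linear[OF s(1) X]) simp
    moreover have "s' ?X = 1 / s ?X"
      unfolding s'_def by (subst push_linear[OF s(1) X]) (simp add: sn_1[OF s(1)] flip: one_pCons)
    ultimately show "push ?O ?X s' [:- c, 1:] = s [:- c, 1:]"
      using X swap_lin[OF s'(1) X', of c] by simp
  qed
  moreover have "push ?O ?X gauss_pt = gauss_pt"
  proof (rule sn_eqI[OF push_seminorm[OF gauss_pt_seminorm] gauss_pt_seminorm])
    show X': "gauss_pt ?X \<noteq> 0" by (simp add: gauss_pt_linear)
    show "push ?O ?X gauss_pt [:- c, 1:] = gauss_pt [:- c, 1:]" for c
      unfolding swap_lin[OF gauss_pt_seminorm X'] by (simp add: gauss_pt_linear max.commute)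
  qed
  ultimately show ?thesis by simp
qed

section \<open>Good reduction\<close>

lemma red_deg_coeff:
  assumes "\<not> red_zero v P"
  shows "1 \<le> v (coeff P (red_deg v P))" "1 \<le> v (coeff P i) \<Longrightarrow> i \<le> red_deg v P"
    "red_deg v P \<le> degree P"
proof -
  have eq: "red_deg v P = (GREATEST i. 1 \<le> v (coeff P i))"
    using assms by (simp add: red_deg_def not_less)
  have bound: "i \<le> degree P" if "1 \<le> v (coeff P i)" for i
    using that by (intro le_degree) auto
  obtain i0 where i0: "1 \<le> v (coeff P i0)" using assms by (auto simp: red_zero_def not_less)
  show 1: "1 \<le> v (coeff P (red_deg v P))"
    unfolding eq by (rule GreatestI_nat[of "\<lambda>i. 1 \<le> v (coeff P i)", OF i0 bound])
  then show "red_deg v P \<le> degree P" by (rule bound)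
  show "i \<le> red_deg v P" if "1 \<le> v (coeff P i)"
    unfolding eq by (rule Greatest_le_nat[of "\<lambda>i. 1 \<le> v (coeff P i)", OF that bound])
qed

text \<open>The powers of 1 give the facts the shape required by \<open>coeff_mult_dominant\<close>
  at radius 1.\<close>

lemma unit_coeffs:
  assumes "integral_poly v P" "\<not> red_zero v P"
  shows "v (coeff P i) * 1 ^ i \<le> 1" "v (coeff P (red_deg v P)) * 1 ^ red_deg v P = 1"
    "red_deg v P < i \<Longrightarrow> v (coeff P i) * 1 ^ i < 1"
proof -
  have "v (coeff P j) \<le> 1" for j using assms(1) by (simp add: integral_poly_def)
  then show "v (coeff P i) * 1 ^ i \<le> 1" "v (coeff P (red_deg v P)) * 1 ^ red_deg v P = 1"
    using red_deg_coeff(1)[OF assms(2)] by (simp_all add: order.antisym)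
  show "v (coeff P i) * 1 ^ i < 1" if "red_deg v P < i"
    using red_deg_coeff(2)[OF assms(2), of i] that by force
qed

lemma red_deg_le_degree: "red_deg v P \<le> degree P"
  using red_deg_coeff(3)[of P] by (cases "red_zero v P") (auto simp: red_deg_def)

text \<open>Modulo the maximal ideal degrees add in H Q, and P differs from H Q only by coefficients
  in that ideal. This bounds the degrees over which \<open>red_map_degree\<close> takes its
  GREATEST.\<close>

lemma red_dvd_red_deg_le:
  assumes H: "integral_poly v H" "\<not> red_zero v H" and P: "\<not> red_zero v P" and "red_dvd v H P"
  shows "red_deg v H \<le> red_deg v P"
proof -
  obtain Q where Q: "integral_poly v Q" and small: "red_zero v (P - H * Q)"
    using assms(4) by (auto simp: red_dvd_def)
  \<comment> \<open>Otherwise H Q, and with it P, would reduce to 0.\<close>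
  have "\<not> red_zero v Q"
  proof
    assume Q0: "red_zero v Q"
    have "v (coeff P i) < 1" for i
    proof -
      have "v (coeff H j * coeff Q (i - j)) < 1" for j
      proof -
        have "v (coeff H j) * v (coeff Q (i - j)) \<le> 1 * v (coeff Q (i - j))"
          using H(1) by (intro mult_right_mono) (auto simp: integral_poly_def)
        then show ?thesis using Q0 by (auto simp: v_mult red_zero_def intro: le_less_trans)
      qed
      then have "v (coeff (H * Q) i) < 1"
        unfolding coeff_mult by (intro v_sum_less) auto
      moreover have "v (coeff (P - H * Q) i) < 1" using small unfolding red_zero_def by blast
      ultimately show ?thesis
        using v_add_le[of "coeff (H * Q) i" "coeff (P - H * Q) i"] by simp
    qed
    then show False using P by (simp add: red_zero_def)
  qed
  then have "v (coeff (H * Q) (red_deg v H + red_deg v Q)) * 1 ^ (red_deg v H + red_deg v Q) = 1 * 1"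
    using H Q by (intro coeff_mult_dominant unit_coeffs) auto
  then have 1: "v (coeff (H * Q) (red_deg v H + red_deg v Q)) = 1" by simp
  have "v (coeff (P - H * Q) (red_deg v H + red_deg v Q)) < 1"
    using small unfolding red_zero_def by blast
  then have "v (coeff P (red_deg v H + red_deg v Q)) = 1"
    using v_add_eq[of "coeff (P - H * Q) (red_deg v H + red_deg v Q)"
        "coeff (H * Q) (red_deg v H + red_deg v Q)"] 1 by simp
  then have "red_deg v H + red_deg v Q \<le> red_deg v P" by (intro red_deg_coeff(2)[OF P]) simp
  then show ?thesis by simp
qed

text \<open>For s(z) > 1 the leading term is strictly larger than all others, its coefficient being
  a unit and theirs integral.\<close>

lemma sn_unit_lead_coeff:
  assumes s: "seminorm s" and z: "s [:0, 1:] > 1" and "integral_poly v P" "v (lead_coeff P) = 1"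
  shows "s P = s [:0, 1:] ^ degree P"
  using assms(3,4)
proof (induction P)
  case (pCons a p)
  show ?case
  proof (cases "p = 0")
    case True
    then show ?thesis using pCons.prems by (simp add: sn_const[OF s])
  next
    case False
    then have p: "s p = s [:0, 1:] ^ degree p"
      using pCons by (simp add: integral_poly_pCons)
    have zp: "s ([:0, 1:] * p) = s [:0, 1:] ^ Suc (degree p)"
      by (subst sn_mult[OF s]) (simp add: p)
    have "v a \<le> 1" using pCons.prems by (simp add: integral_poly_pCons)
    also have "1 < s [:0, 1:] ^ Suc (degree p)" using z by (rule one_less_power) simp
    finally have "s ([:0, 1:] * p + [:a:]) = s ([:0, 1:] * p)"
      using zp by (intro sn_add_eq[OF s]) (simp only: sn_const[OF s])
    then show ?thesis using zp False by (simp add: add.commute)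
  qed
qed simp

text \<open>Good reduction means that the reduced forms have no common zero on the projective line
  over the residue field. For s(z) <= 1 this is used at residue classes of integral a; for s(z) > 1
  it is used at infinity, as the statement that one of F, G keeps the full degree d under
  reduction.\<close>

lemma good_reduction_norm:
  assumes good: "good_reduction v F G" and s: "seminorm s"
  shows "max 1 (s [:0, 1:]) ^ rdeg F G \<le> max (s F) (s G)"
proof -
  have int: "integral_poly v F" "integral_poly v G"
    and unit: "\<exists>i. v (coeff F i) = 1 \<or> v (coeff G i) = 1"
    and deg: "red_map_degree v F G = rdeg F G"
    using good by (auto simp: good_reduction_def normalized_def)
  show ?thesis
  proof (cases "rdeg F G = 0")
    case True
    then obtain f g where fg: "F = [:f:]" "G = [:g:]"
      by (auto simp: rdeg_def elim!: degree_eq_zeroE)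
    then show ?thesis
      using unit True by (auto simp: sn_const[OF s] coeff_pCons le_max_iff_disj split: nat.splits)
  next
    case False
    define S where "S k \<longleftrightarrow> (\<exists>H. integral_poly v H \<and> \<not> red_zero v H \<and> red_deg v H = k \<and>
       red_dvd v H F \<and> red_dvd v H G)" for k
    have rm: "max (red_deg v F) (red_deg v G) - (GREATEST k. S k) = rdeg F G"
      using deg by (simp add: red_map_degree_def S_def)
    \<comment> \<open>Nothing may be lost in the subtraction: the first term must equal
      \<open>rdeg F G\<close> and the second must be 0. For \<open>rdeg F G\<close> = 0 truncated
      subtraction would say nothing about the second term, hence the separate case.\<close>
    moreover have "max (red_deg v F) (red_deg v G) \<le> rdeg F G"
      using red_deg_le_degree[of F] red_deg_le_degree[of G] by (auto simp: rdeg_def)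
    ultimately have max: "max (red_deg v F) (red_deg v G) = rdeg F G" and G0: "(GREATEST k. S k) = 0"
      using False by auto
    obtain P where P: "P \<in> {F, G}" "\<not> red_zero v P"
      using unit by (auto simp: red_zero_def) (metis less_irrefl)+
    \<comment> \<open>The bound matters: GREATEST is unspecified for an unbounded predicate.\<close>
    have "k \<le> red_deg v P" if "S k" for k
      using that P red_dvd_red_deg_le[of _ P] by (auto simp: S_def)
    then have S0: "k \<le> 0" if "S k" for k
      using Greatest_le_nat[of S k, OF that] G0 by metis
    \<comment> \<open>A common zero of the reductions at the class of a would make z - a a common
      divisor of reduced degree at least 1.\<close>
    have no_common: "1 \<le> max (v (poly F a)) (v (poly G a))" if a: "v a \<le> 1" for a
    proof (rule ccontr)
      assume "\<not> ?thesis"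
      then have small: "v (poly F a) < 1" "v (poly G a) < 1" by auto
      let ?H = "[:- a, 1:]"
      have H1: "\<not> red_zero v ?H" by (auto simp: red_zero_def intro!: exI[of _ "Suc 0"])
      have dvd: "red_dvd v ?H P" if "integral_poly v P" "v (poly P a) < 1" for P
        unfolding red_dvd_def
      proof (intro exI conjI)
        have "P - ?H * synthetic_div P a = [:poly P a:]"
          using synthetic_div_correct'[of a P] by (metis add_diff_cancel_left')
        then show "red_zero v (P - ?H * synthetic_div P a)"
          using that by (auto simp: red_zero_def coeff_pCons split: nat.splits)
      qed (rule integral_synthetic_div[OF a that(1)])
      have "integral_poly v ?H" using a by (simp add: integral_poly_pCons) (simp add: integral_poly_def)
      then have "S (red_deg v ?H)"
        unfolding S_def using H1 dvd[OF int(1) small(1)] dvd[OF int(2) small(2)] by blast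
      moreover have "Suc 0 \<le> red_deg v ?H" by (rule red_deg_coeff(2)[OF H1]) simp
      ultimately show False using S0 by fastforce
    qed
    show ?thesis
    proof (cases "s [:0, 1:] \<le> 1")
      case z: True
      have "1 \<le> max (s F) (s G)"
      proof (cases "\<exists>a. v a \<le> 1 \<and> s [:- a, 1:] < 1")
        case True
        then obtain a where a: "v a \<le> 1" "s [:- a, 1:] < 1" by blast
        then show ?thesis
          using no_common[OF a(1)] sn_near_value(2)[OF s z int(1) a(1)]
            sn_near_value(2)[OF s z int(2) a(1)] by linarith
      next
        case far: False
        \<comment> \<open>A point of the unit disc at distance at least 1 from every integral centre
          is the Gauss point. There a polynomial is at least as large as each of its coefficients,
          and some coefficient of F or G is a unit.\<close>
        have "s = gauss_pt"
        proof (rule sn_eqI[OF s gauss_pt_seminorm])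
          fix c
          show "s [:- c, 1:] = gauss_pt [:- c, 1:]"
            using far[simplified, rule_format, of c] z sn_linear_le[OF s, of c 0] v_diff_le_sn[OF s, of c 0]
            by (cases "v c \<le> 1") (auto simp: gauss_pt_linear)
        qed
        then have "v (coeff P i) \<le> s P" for P i
          using gauss_ge[of 1 P i] by (simp add: gauss_pt_def disc_def pcompose_idR)
        then show ?thesis using unit by (metis max.coboundedI1 max.coboundedI2)
      qed
      then show ?thesis using z by (simp add: max_absorb1)
    next
      case z: False
      obtain P where P: "P \<in> {F, G}" "red_deg v P = rdeg F G"
        using max by (metis insertCI max_def)
      then have nz: "\<not> red_zero v P" using False by (auto simp: red_deg_def)
      have "degree P = rdeg F G"
        using P red_deg_le_degree[of P] by (auto simp: rdeg_def)
      moreover have "v (lead_coeff P) = 1"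
        using red_deg_coeff(1)[OF nz] P int calculation by (auto simp: integral_poly_def intro!: antisym)
      ultimately have "s P = s [:0, 1:] ^ rdeg F G"
        using sn_unit_lead_coeff[OF s, of P] z P int by auto
      then show ?thesis using P z by (auto simp: max_def)
    qed
  qed
qed

section \<open>Counting components\<close>

lemma fixed_arc_potential_good_reduction:
  assumes comp: "complete_abs v" and pgr: "potential_good_reduction v F G"
  obtains \<zeta> where
    "\<And>s. seminorm s \<Longrightarrow> no_zero s \<Longrightarrow> lin_fixed s F G \<Longrightarrow> fixed_arc F G s \<zeta>"
proof -
  define d where "d = rdeg F G"
  have dFG: "degree F \<le> d" "degree G \<le> d" by (auto simp: d_def rdeg_def)
  obtain a b c e l where det: "a * e - b * c \<noteq> 0" and l: "l \<noteq> 0"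
    and good: "good_reduction v (smult l (conj_num a b c e F G)) (smult l (conj_den a b c e F G))"
    using pgr unfolding potential_good_reduction_def by blast
  \<comment> \<open>The inverse of sigma is written with the adjugate matrix, so undoing a change of
    coordinate leaves the determinant behind. This explains the scalars \<open>\<Delta> ^ d\<close>
    and \<open>l * \<Delta>\<close> below.\<close>
  define \<Delta> where "\<Delta> = a * e - b * c"
  \<comment> \<open>\<open>?A\<close> / \<open>?B\<close> is the inverse of sigma and
    \<open>?U\<close> / \<open>?W\<close> is sigma itself.\<close>
  let ?A = "[:- b, e:]" and ?B = "[:a, - c:]" and ?U = "[:b, a:]" and ?W = "[:e, c:]"
  define F1 where "F1 = smult l (conj_num a b c e F G)"
  define G1 where "G1 = smult l (conj_den a b c e F G)"
  define hF where "hF = hsub F d ?A ?B"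
  define hG where "hG = hsub G d ?A ?B"
  have F1: "F1 = smult l (smult a hF + smult b hG)"
    by (simp add: F1_def conj_num_def hF_def hG_def d_def Let_def)
  have G1: "G1 = smult l (smult c hF + smult e hG)"
    by (simp add: G1_def conj_den_def hF_def hG_def d_def Let_def)
  have deg1: "degree F1 \<le> d" "degree G1 \<le> d"
    unfolding F1 G1 hF_def hG_def
    by (intro degree_add_le degree_hsub_le order.trans[OF degree_smult_le]; simp)+
  have comp_id: "hsub (hsub P d ?A ?B) d ?U ?W = smult (\<Delta> ^ d) P" if "degree P \<le> d" for P
  proof -
    have "hsub (hsub P d ?A ?B) d ?U ?W = hsub P d [:0, \<Delta>:] [:\<Delta>:]"
      by (subst hsub_hsub) (simp_all add: hsub_linear \<Delta>_def algebra_simps)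
    then show ?thesis using hsub_scaled_id[OF that] by simp
  qed
  have k: "1 / (l * \<Delta> ^ d) \<noteq> 0" "l * \<Delta> \<noteq> 0" using l det by (auto simp: \<Delta>_def)
  \<comment> \<open>With \<open>toG\<close> this says that F1/G1 after sigma equals sigma after F/G;
    \<open>fromF\<close> and \<open>fromG\<close> are the same relation for the inverse of
    sigma.\<close>
  have toF: "smult (1 / (l * \<Delta> ^ d)) (hsub F1 d ?U ?W) = smult a F + smult b G"
    unfolding F1 hsub_smult hsub_add hF_def hG_def comp_id[OF dFG(1)] comp_id[OF dFG(2)]
    using k by (simp add: smult_add_right)
  have toG: "smult (1 / (l * \<Delta> ^ d)) (hsub G1 d ?U ?W) = smult c F + smult e G"
    unfolding G1 hsub_smult hsub_add hF_def hG_def comp_id[OF dFG(1)] comp_id[OF dFG(2)]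
    using k by (simp add: smult_add_right)
  have fromF: "smult (l * \<Delta>) (hsub F d ?A ?B) = smult e F1 + smult (- b) G1"
    unfolding hF_def[symmetric] F1 G1
    by (rule poly_eqI) (simp add: \<Delta>_def algebra_simps)
  have fromG: "smult (l * \<Delta>) (hsub G d ?A ?B) = smult (- c) F1 + smult a G1"
    unfolding hG_def[symmetric] F1 G1
    by (rule poly_eqI) (simp add: \<Delta>_def algebra_simps)
  have int: "integral_poly v F1" "integral_poly v G1"
    using good by (auto simp: F1_def G1_def good_reduction_def normalized_def)
  show ?thesis
  proof (rule that)
    fix s assume s: "seminorm s" "no_zero s" "lin_fixed s F G"
    define s' where "s' = push ?U ?W s"
    have W: "s ?W \<noteq> 0" using det by (intro no_zeroD s) auto
    have s': "seminorm s'" "no_zero s'"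
      unfolding s'_def using det
      by (auto intro!: push_seminorm push_no_zero s W simp: mult.commute)
    have "lin_fixed s' F1 G1"
      unfolding s'_def by (rule lin_fixed_push[OF s(1,3) W deg1 k(1) toF toG])
    then have "fixed_arc F1 G1 s' gauss_pt"
      using good_reduction_norm[OF good s'(1)]
      by (intro fixed_arc_gauss[OF s' comp int, where d = "rdeg F1 G1"])
        (auto simp: F1_def G1_def rdeg_def)
    then have "fixed_arc F G (push ?A ?B s') (push ?A ?B gauss_pt)"
      by (rule fixed_arc_push[OF _ _ dFG k(2) fromF fromG]) (use det in \<open>simp add: algebra_simps\<close>)
    moreover have "push ?A ?B s' = s"
    proof -
      have lin: "s' (smult p ?A + smult q ?B) = v \<Delta> * s [:q, p:] / s ?W" for p q
      proof -
        have "s' (smult p ?A + smult q ?B) = s' [:q * a - p * b, p * e - q * c:]"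
          by (simp add: algebra_simps)
        also have "\<dots> = s (smult (p * e - q * c) ?U + smult (q * a - p * b) ?W) / s ?W"
          unfolding s'_def by (rule push_linear[OF s(1) W])
        also have "smult (p * e - q * c) ?U + smult (q * a - p * b) ?W = smult \<Delta> [:q, p:]"
          by (simp add: \<Delta>_def algebra_simps)
        finally show ?thesis by (simp only: sn_smult[OF s(1)])
      qed
      have B: "s' ?B = v \<Delta> / s ?W" using lin[of 0 1] by (simp add: sn_1[OF s(1)] flip: one_pCons)
      then have B0: "s' ?B \<noteq> 0" using W det by (simp add: \<Delta>_def)
      show ?thesis
      proof (rule sn_eqI[OF push_seminorm[OF s'(1) B0] s(1)])
        fix x
        show "push ?A ?B s' [:- x, 1:] = s [:- x, 1:]"
          unfolding push_linear[OF s'(1) B0] lin B using W det by (simp add: \<Delta>_def)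
      qed
    qed
    ultimately show "fixed_arc F G s (push ?A ?B gauss_pt)" by simp
  qed
qed

text \<open>The weak topology is a pullback along \<open>berk_val\<close>, so continuity in each f
  makes the arc a continuous image of an interval inside the fixed locus.\<close>

lemma fixed_arc_connected:
  assumes "fixed_arc F G s s'"
  shows "connected_component_of (subtopology (berk_top v) (fixed_locus v F G)) (Some s) (Some s')"
proof -
  obtain \<gamma> where g: "\<gamma> 0 = s" "\<gamma> 1 = s'"
    "\<And>t. t \<in> {0..1} \<Longrightarrow> seminorm (\<gamma> t) \<and> lin_fixed (\<gamma> t) F G"
    "\<And>f. continuous_on {0..1::real} (\<lambda>t. \<gamma> t f)"
    using assms unfolding fixed_arc_def by blast
  have "continuous_on {0..1} (\<lambda>t. berk_val v (Some (\<gamma> t)))"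
    unfolding berk_val_def
    by (intro continuous_on_coordinatewise_then_product) (simp add: continuous_on_ennreal g)
  then have "continuous_map (top_of_set {0..1}) euclidean (berk_val v \<circ> (\<lambda>t. Some (\<gamma> t)))"
    by (simp add: comp_def)
  then have "continuous_map (top_of_set {0..1}) (berk_top v) (\<lambda>t. Some (\<gamma> t))"
    unfolding berk_top_def using g(3)
    by (intro continuous_map_pullback') (auto simp: berk_P1_def)
  moreover have "Some (\<gamma> t) \<in> fixed_locus v F G" if "t \<in> {0..1}" for t
    using g(3)[OF that] by (auto simp: fixed_locus_def berk_P1_def berk_map_fixed_iff)
  ultimately have "continuous_map (top_of_set {0..1})
      (subtopology (berk_top v) (fixed_locus v F G)) (\<lambda>t. Some (\<gamma> t))"
    by (auto simp: continuous_map_in_subtopology)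
  then have "connectedin (subtopology (berk_top v) (fixed_locus v F G)) ((\<lambda>t. Some (\<gamma> t)) ` {0..1})"
    by (rule connectedin_continuous_map_image) (simp add: connectedin_subtopology)
  moreover have "Some s \<in> (\<lambda>t. Some (\<gamma> t)) ` {0..1}" "Some s' \<in> (\<lambda>t. Some (\<gamma> t)) ` {0..1}"
    using g(1,2) by force+
  ultimately show ?thesis unfolding connected_component_of_def by blast
qed

section \<open>Classical fixed points\<close>

definition classical_fixed :: "'a poly \<Rightarrow> 'a poly \<Rightarrow> ('a poly \<Rightarrow> real) option set" where
  "classical_fixed F G = fixed_locus v F G \<inter> insert None (range (type1 v))"

lemma type1_fixed_root:
  assumes "type1 v c \<in> fixed_locus v F G"
  shows "poly (F - [:0, 1:] * G) c = 0"
proof -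
  have G: "poly G c \<noteq> 0" and "push F G (\<lambda>g. v (poly g c)) = (\<lambda>g. v (poly g c))"
    using assms by (auto simp: fixed_locus_def type1_def berk_map_def push_def fun_eq_iff split: if_splits)
  \<comment> \<open>At z - c the right-hand side vanishes, while the left-hand side is |F(c)/G(c) -
    c|.\<close>
  then have "push F G (\<lambda>g. v (poly g c)) [:- c, 1:] = 0" by simp
  then show ?thesis using G by (simp add: push_def hsub_linear)
qed

text \<open>Finite fixed points are roots of F - z G, whose degree is at most max (deg F) (deg G +
  1). Infinity is fixed only if deg F > deg G, and then that degree is at most d, so the total is d
  + 1 in either case.\<close>

lemma card_classical_fixed:
  assumes "rat_map F G" "rdeg F G \<ge> 2"
  shows "finite (classical_fixed F G) \<and> card (classical_fixed F G) \<le> rdeg F G + 1"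
proof -
  define Q where "Q = F - [:0, 1:] * G"
  define I where "I = (if degree F > degree G then {None :: ('a poly \<Rightarrow> real) option} else {})"
  have G: "G \<noteq> 0" and cop: "coprime F G" using assms(1) by (auto simp: rat_map_def)
  \<comment> \<open>Q = 0 would make the map the identity; coprimality then forces G to be constant
    and the degree to be at most 1.\<close>
  have "Q \<noteq> 0"
  proof
    assume "Q = 0"
    then have F: "F = [:0, 1:] * G" by (simp add: Q_def)
    then have "is_unit G" using cop by (metis coprime_common_divisor dvd_refl dvd_triv_right)
    then have "degree G = 0" using is_unit_iff_degree[OF G] by blast
    moreover have "degree F \<le> 1 + degree G" unfolding F using degree_mult_le[of "[:0, 1:]" G] by simp
    ultimately show False using assms(2) by (simp add: rdeg_def)
  qed
  have sub: "classical_fixed F G \<subseteq> I \<union> type1 v ` {c. poly Q c = 0}"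
  proof
    fix x assume x: "x \<in> classical_fixed F G"
    then consider "x = None" | c where "x = type1 v c" by (auto simp: classical_fixed_def)
    then show "x \<in> I \<union> type1 v ` {c. poly Q c = 0}"
    proof cases
      case 1
      then show ?thesis using x
        by (auto simp: classical_fixed_def fixed_locus_def berk_map_def type1_def I_def split: if_splits)
    next
      case 2
      then show ?thesis using x type1_fixed_root[of c F G] by (auto simp: classical_fixed_def Q_def)
    qed
  qed
  have fin: "finite {c. poly Q c = 0}" using \<open>Q \<noteq> 0\<close> by (rule poly_roots_finite)
  have "degree ([:0, 1:] * G) \<le> Suc (degree G)" using degree_mult_le[of "[:0, 1:]" G] by simp
  then have "degree Q \<le> max (degree F) (Suc (degree G))"
    unfolding Q_def by (intro degree_diff_le) auto
  then have "card I + degree Q \<le> rdeg F G + 1" by (auto simp: I_def rdeg_def)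
  moreover have "card {c. poly Q c = 0} \<le> degree Q" using \<open>Q \<noteq> 0\<close> by (rule card_poly_roots_bound)
  moreover have "card (I \<union> type1 v ` {c. poly Q c = 0}) \<le> card I + card {c. poly Q c = 0}"
    using card_Un_le[of I "type1 v ` {c. poly Q c = 0}"] card_image_le[OF fin, of "type1 v"] by linarith
  moreover have finU: "finite (I \<union> type1 v ` {c. poly Q c = 0})" using fin by (simp add: I_def)
  ultimately show ?thesis
    using finite_subset[OF sub finU] card_mono[OF finU sub] by linarith
qed

end

theorem theorem3p10:
  fixes v :: "'a::field \<Rightarrow> real" and F G :: "'a poly" and d :: nat
  assumes "nonarch_abs v" and "nontrivial_abs v" and "complete_abs v"
    and "alg_closed TYPE('a)" and "CHAR('a) = 0"
    and "rat_map F G" and "normalized v F G"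
    and "d = rdeg F G" and "d \<ge> 2"
    and "potential_good_reduction v F G"
  shows "finite (connected_components_of (subtopology (berk_top v) (fixed_locus v F G))) \<and>
         card (connected_components_of (subtopology (berk_top v) (fixed_locus v F G))) \<le> d + 2"
proof -
  interpret nonarch_field v by unfold_locales fact+
  let ?X = "subtopology (berk_top v) (fixed_locus v F G)"
  obtain \<zeta> where \<zeta>: "\<And>s. seminorm s \<Longrightarrow> no_zero s \<Longrightarrow> lin_fixed s F G \<Longrightarrow> fixed_arc F G s \<zeta>"
    using fixed_arc_potential_good_reduction[OF assms(3,10)] by blast
  \<comment> \<open>Every component meets T. If \<zeta> happens not to be fixed, its component is
    the empty set, which does no harm since only an inclusion is claimed.\<close>
  define T where "T = insert (Some \<zeta>) (classical_fixed F G)"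
  have fin: "finite (classical_fixed F G)" and card: "card (classical_fixed F G) \<le> d + 1"
    using card_classical_fixed[of F G] assms by auto
  have sub: "connected_components_of ?X \<subseteq> connected_component_of_set ?X ` T"
  proof
    fix C assume "C \<in> connected_components_of ?X"
    then obtain x where x: "x \<in> topspace ?X" and C: "C = connected_component_of_set ?X x"
      by (auto simp: connected_components_of_def)
    from x have x': "x \<in> fixed_locus v F G" by simp
    show "C \<in> connected_component_of_set ?X ` T"
    proof (cases "x \<in> classical_fixed F G")
      case True
      then show ?thesis using C by (auto simp: T_def)
    next
      case False
      then obtain s where s: "x = Some s" "seminorm s" "lin_fixed s F G"
        using x' by (auto simp: classical_fixed_def fixed_locus_def berk_P1_def berk_map_fixed_iff)
      have "no_zero s"
        using False x' sn_eq_type1[OF s(2)] s(1) by (auto simp: no_zero_def classical_fixed_def)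
      then have "connected_component_of ?X x (Some \<zeta>)"
        using s \<zeta> fixed_arc_connected by blast
      then have "C = connected_component_of_set ?X (Some \<zeta>)"
        unfolding C by (metis connected_component_of_equiv)
      then show ?thesis by (simp add: T_def)
    qed
  qed
  have "finite T" "card T \<le> d + 2" using fin card by (auto simp: T_def card_insert_if)
  then show ?thesis
    using sub surj_card_le[OF _ sub] finite_surj[OF _ sub] by (meson order.trans)
qed

end
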